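(* For every integer $m\le 0$ the set $I_m$ is closed, and for every integer $m\ge1$ the set $S_m$ is closed (as subsets of $[0,\infty]$), where $$I_m=\left\{\liminf_{k\to\infty}q_{k+m}\|q_k\alpha\| : \alpha\in[0,1]\setminus\mathbb{Q}\right\}\ (m\le0),\qquad S_m=\left\{\limsup_{k\to\infty}q_{k+m}\|q_k\alpha\| : \alpha\in[0,1]\setminus\mathbb{Q}\right\}\ (m\ge1).$$
   Context: For irrational $\alpha\in[0,1]$, $q_k=q_k(\alpha)$ denotes the denominator of the $k$-th best approximant (of the second kind), i.e. of the $k$-th continued fraction convergent $p_k/q_k$ of $\alpha$. $\|x\|$ denotes the distance from $x$ to $\mathbb{Z}$. The value $\infty$ is allowed. *)

theory Defs
  imports "HOL-Analysis.Analysis"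
begin

text \<open>The convergent \<open>[a\<^sub>0; a\<^sub>1, \<dots>, a\<^sub>k]\<close> of the regular continued fraction expansion of \<open>x\<close>,
  with \<open>a\<^sub>0 = \<lfloor>x\<rfloor>\<close>. The recursion peels off the first partial quotient and passes to the
  next complete quotient, so no division by zero occurs when \<open>x\<close> is irrational.\<close>

primrec convergent_cf :: "nat \<Rightarrow> real \<Rightarrow> rat" where
  "convergent_cf 0 x = of_int \<lfloor>x\<rfloor>"
| "convergent_cf (Suc k) x = of_int \<lfloor>x\<rfloor> + 1 / convergent_cf k (1 / frac x)"

definition cf_denom :: "real \<Rightarrow> nat \<Rightarrow> int" where
  "cf_denom \<alpha> k = snd (quotient_of (convergent_cf k \<alpha>))"

text \<open>The type \<^typ>\<open>ennreal\<close> is the space \<open>[0, \<infinity>]\<close> with its order topology. For \<open>m < 0\<close> the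
  truncation in \<open>nat (int k + m)\<close> affects only the finitely many indices \<open>k < -m\<close>, hence neither
  the lower nor the upper limit.\<close>

definition approx_seq :: "int \<Rightarrow> real \<Rightarrow> nat \<Rightarrow> ennreal" where
  "approx_seq m \<alpha> k =
     ennreal (of_int (cf_denom \<alpha> (nat (int k + m))) * infdist (of_int (cf_denom \<alpha> k) * \<alpha>) \<int>)"

definition I_set :: "int \<Rightarrow> ennreal set" where
  "I_set m = {liminf (approx_seq m \<alpha>) |\<alpha>. \<alpha> \<in> {0..1} - \<rat>}"

definition S_set :: "int \<Rightarrow> ennreal set" where
  "S_set m = {limsup (approx_seq m \<alpha>) |\<alpha>. \<alpha> \<in> {0..1} - \<rat>}"

end

theory Submission
  imports Defs
begin

text \<open>Write \<open>\<alpha> = [0; a\<^sub>1, a\<^sub>2, \<dots>]\<close>. For \<open>k \<ge> 1\<close> one has \<open>q\<^sub>k \<parallel>q\<^sub>k \<alpha>\<parallel> = 1 / (a\<^bsub>k+1\<^esub> + y + x)\<close> where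
  \<open>y = [0; a\<^sub>k, \<dots>, a\<^sub>1]\<close> and \<open>x = [0; a\<^bsub>k+2\<^esub>, \<dots>]\<close>, and the quotients of consecutive denominators are
  continued fractions that read the digits backwards. So \<open>q\<^bsub>k+m\<^esub> \<parallel>q\<^sub>k \<alpha>\<parallel>\<close> depends on all digits, but
  on far ones only exponentially little: up to \<open>O(2\<^sup>-\<^sup>N)\<close> it is a function of the digits at distance
  at most \<open>N\<close> from \<open>k\<close>, uniformly for bounded digits (\<open>window_regular_approx\<close>).

  Large digits push the sequence towards one extreme value: \<open>0\<close> for \<open>m \<le> 0\<close>, \<open>1\<close> for \<open>m = 1\<close> and
  \<open>\<infinity>\<close> for \<open>m \<ge> 2\<close>. This value belongs to the set, since the number with digits \<open>1, 2, 3, \<dots>\<close> attains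
  it. If a limit \<open>w\<close> of elements \<open>v\<^sub>n\<close> of the set is any other value, then the corresponding \<open>\<alpha>\<^sub>n\<close>
  eventually have digits below one common bound \<open>M\<close>.

  It remains to realize \<open>w\<close> (\<open>extremal_cluster_limit\<close>). By compactness of \<open>{0..M}\<^sup>\<int>\<close> the
  surroundings of positions in \<open>\<alpha>\<^sub>n\<close> where the value is close to \<open>v\<^sub>n\<close> accumulate at a two-sided
  sequence \<open>\<theta>\<^sub>n\<close>, and after passing to a subsequence the \<open>\<theta>\<^sub>n\<close> converge to some \<open>\<theta>\<close>. Hence \<open>\<alpha>\<^sub>n\<close>
  contains, arbitrarily far out, two occurrences of a long central piece of \<open>\<theta>\<close>. The digits of
  \<open>\<alpha>\<^sub>n\<close> between the two form the \<open>n\<close>-th block, and the blocks are concatenated. Near a cut between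
  two blocks the digits on both sides continue as in \<open>\<theta>\<close>, so that every long window of the new
  sequence occurs in some \<open>\<alpha>\<^sub>n\<close> (\<open>glue_blocks\<close>). No value beyond the limit of the \<open>v\<^sub>n\<close> is created at
  the cuts, while values close to \<open>v\<^sub>n\<close> do occur there. The number with these digits
  (\<open>ex_unit_irrat_digits\<close>) has extremal value \<open>w\<close>.\<close>

section \<open>Continued fractions of irrational numbers in the unit interval\<close>

definition unit_irrats :: "real set" where
  "unit_irrats = {0<..<1} - \<rat>"

definition gauss :: "real \<Rightarrow> real" where
  "gauss t = frac (1 / t)"

text \<open>The tail \<open>[0; a\<^bsub>k+1\<^esub>, a\<^bsub>k+2\<^esub>, \<dots>]\<close> of \<open>t = [0; a\<^sub>1, a\<^sub>2, \<dots>]\<close>.\<close>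

definition cf_tail :: "real \<Rightarrow> nat \<Rightarrow> real" where
  "cf_tail t k = (gauss ^^ k) t"

text \<open>This is \<open>a\<^bsub>k+1\<^esub>\<close>: digits are counted from \<open>0\<close>.\<close>

definition cf_digit :: "real \<Rightarrow> nat \<Rightarrow> nat" where
  "cf_digit t k = nat \<lfloor>1 / cf_tail t k\<rfloor>"

fun cf_q :: "real \<Rightarrow> nat \<Rightarrow> nat" where
  "cf_q t 0 = 1"
| "cf_q t (Suc 0) = cf_digit t 0"
| "cf_q t (Suc (Suc k)) = cf_digit t (Suc k) * cf_q t (Suc k) + cf_q t k"

text \<open>The number \<open>q\<^bsub>k-1\<^esub> / q\<^sub>k = [0; a\<^sub>k, \<dots>, a\<^sub>1]\<close>: the expansion read backwards from position \<open>k\<close>.\<close>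

fun cf_past :: "real \<Rightarrow> nat \<Rightarrow> real" where
  "cf_past t 0 = 0"
| "cf_past t (Suc k) = 1 / (cf_digit t k + cf_past t k)"

text \<open>The distance \<open>\<bar>q\<^sub>k t - p\<^sub>k\<bar>\<close>, see \<open>abs_convergent_error\<close> below.\<close>

definition cf_err :: "real \<Rightarrow> nat \<Rightarrow> real" where
  "cf_err t k = (\<Prod>i\<le>k. cf_tail t i)"

lemma cf_tail_0 [simp]: "cf_tail t 0 = t"
  by (simp add: cf_tail_def)

lemma cf_tail_Suc: "cf_tail t (Suc k) = gauss (cf_tail t k)"
  by (simp add: cf_tail_def)

lemma cf_tail_gauss: "cf_tail (gauss t) k = cf_tail t (Suc k)"
  by (simp add: cf_tail_def funpow_swap1)

lemma cf_digit_gauss: "cf_digit (gauss t) k = cf_digit t (Suc k)"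
  by (simp add: cf_digit_def cf_tail_gauss)

lemma gauss_unit_irrats: "t \<in> unit_irrats \<Longrightarrow> gauss t \<in> unit_irrats"
proof -
  assume t: "t \<in> unit_irrats"
  have "1 / t \<notin> \<rat>"
    using t Rats_divide[of 1 "1 / t"] by (auto simp: unit_irrats_def)
  moreover have "1 / t = of_int \<lfloor>1 / t\<rfloor> + gauss t"
    by (simp add: gauss_def frac_def)
  ultimately have "gauss t \<notin> \<rat>"
    by (metis Rats_add Rats_of_int)
  moreover from this have "gauss t \<noteq> 0"
    by auto
  ultimately show ?thesis
    using frac_ge_0[of "1 / t"] frac_lt_1[of "1 / t"] by (auto simp: unit_irrats_def gauss_def)
qed

lemma cf_tail_unit_irrats: "t \<in> unit_irrats \<Longrightarrow> cf_tail t k \<in> unit_irrats"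
  by (induction k) (auto simp: cf_tail_Suc gauss_unit_irrats)

lemma cf_tail_bounds:
  assumes "t \<in> unit_irrats"
  shows "0 < cf_tail t k" "cf_tail t k < 1"
  using cf_tail_unit_irrats[OF assms, of k] by (auto simp: unit_irrats_def)

lemma inverse_cf_tail:
  assumes "t \<in> unit_irrats"
  shows "1 / cf_tail t k = cf_digit t k + cf_tail t (Suc k)"
proof -
  have "0 \<le> \<lfloor>1 / cf_tail t k\<rfloor>"
    using cf_tail_bounds[OF assms, of k] by simp
  then show ?thesis
    by (simp add: cf_digit_def cf_tail_Suc gauss_def frac_def)
qed

lemma cf_tail_eq:
  assumes "t \<in> unit_irrats"
  shows "cf_tail t k = 1 / (cf_digit t k + cf_tail t (Suc k))"
  using arg_cong[OF inverse_cf_tail[OF assms, of k], of "\<lambda>x. 1 / x"] by simp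

lemma cf_digit_pos:
  assumes "t \<in> unit_irrats"
  shows "0 < cf_digit t k"
proof -
  have "1 \<le> 1 / cf_tail t k"
    using cf_tail_bounds[OF assms, of k] by (simp add: field_simps)
  then have "1 \<le> \<lfloor>1 / cf_tail t k\<rfloor>"
    by (simp add: le_floor_iff)
  then show ?thesis
    by (simp add: cf_digit_def)
qed

lemma cf_digit_ge1: "t \<in> unit_irrats \<Longrightarrow> 1 \<le> real (cf_digit t k)"
  using cf_digit_pos[of t k] by linarith

lemma cf_q_pos: "t \<in> unit_irrats \<Longrightarrow> 0 < cf_q t k"
  by (induction t k rule: cf_q.induct) (auto simp: cf_digit_pos)

text \<open>The denominators are defined by the recursion at the last digit, whereas convergents are
  built from the first digit. This symmetry of continuants connects the two.\<close>

lemma cf_q_first_digit: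
  "cf_q t (Suc (Suc k)) = cf_digit t 0 * cf_q (gauss t) (Suc k) + cf_q (gauss (gauss t)) k"
proof (induction k rule: induct_nat_012)
  case (ge2 n)
  have "cf_q t (Suc (Suc (Suc (Suc n)))) =
      cf_digit t (Suc (Suc (Suc n))) * cf_q t (Suc (Suc (Suc n))) + cf_q t (Suc (Suc n))"
    by simp
  also have "\<dots> = cf_digit t 0 *
      (cf_digit (gauss t) (Suc (Suc n)) * cf_q (gauss t) (Suc (Suc n)) + cf_q (gauss t) (Suc n))
      + (cf_digit (gauss (gauss t)) (Suc n) * cf_q (gauss (gauss t)) (Suc n)
      + cf_q (gauss (gauss t)) n)"
    unfolding ge2 cf_digit_gauss by (simp only: algebra_simps)
  finally show ?case by simp
qed (auto simp: cf_digit_gauss algebra_simps)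

lemma coprime_consecutive:
  assumes "t \<in> unit_irrats"
  shows "coprime (cf_q t (Suc k)) (cf_q (gauss t) k)"
  using assms
proof (induction k arbitrary: t)
  case 0
  then show ?case by simp
next
  case (Suc k)
  have "coprime (cf_q (gauss t) (Suc k)) (cf_q (gauss (gauss t)) k)"
    using Suc gauss_unit_irrats by blast
  then have "coprime (cf_q (gauss (gauss t)) k + cf_digit t 0 * cf_q (gauss t) (Suc k))
      (cf_q (gauss t) (Suc k))"
    using gcd_add_mult[of "cf_q (gauss t) (Suc k)" "cf_digit t 0" "cf_q (gauss (gauss t)) k"]
    by (simp only: coprime_iff_gcd_eq_1 gcd.commute add.commute)
  then show ?case
    by (simp only: cf_q_first_digit add.commute)
qed

lemma convergent_cf_inverse:
  assumes "t \<in> unit_irrats"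
  shows "convergent_cf k (1 / t) = Fract (int (cf_q t (Suc k))) (int (cf_q (gauss t) k))"
  using assms
proof (induction k arbitrary: t)
  case 0
  have "0 \<le> \<lfloor>1 / t\<rfloor>"
    using 0 by (auto simp: unit_irrats_def)
  then show ?case
    by (simp add: cf_digit_def of_int_rat)
next
  case (Suc k)
  have g: "gauss t \<in> unit_irrats"
    using Suc gauss_unit_irrats by blast
  have "0 \<le> \<lfloor>1 / t\<rfloor>"
    using Suc.prems by (auto simp: unit_irrats_def)
  then have fl: "\<lfloor>1 / t\<rfloor> = int (cf_digit t 0)"
    by (simp add: cf_digit_def)
  let ?A = "int (cf_q (gauss t) (Suc k))" and ?B = "int (cf_q (gauss (gauss t)) k)"
  have pos: "0 < ?A" "0 < ?B"
    using g gauss_unit_irrats cf_q_pos by (auto simp: of_nat_0_less_iff simp del: cf_q.simps)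
  have "convergent_cf (Suc k) (1 / t) = of_int (int (cf_digit t 0)) + 1 / Fract ?A ?B"
    using Suc.IH[OF g] fl by (simp add: gauss_def del: cf_q.simps)
  also have "\<dots> = Fract (int (cf_digit t 0) * ?A + ?B) ?A"
    using pos by (simp add: Fract_of_int_quotient field_simps del: cf_q.simps)
  also have "int (cf_digit t 0) * ?A + ?B = int (cf_q t (Suc (Suc k)))"
    by (simp only: cf_q_first_digit of_nat_add of_nat_mult)
  finally show ?case .
qed

lemma cf_denom_eq:
  assumes "t \<in> unit_irrats"
  shows "cf_denom t k = int (cf_q t k)"
proof (cases k)
  case 0
  then show ?thesis by (simp add: cf_denom_def quotient_of_int)
next
  case (Suc j)
  have t: "0 < t" "t < 1"
    using assms by (auto simp: unit_irrats_def)
  then have "\<lfloor>t\<rfloor> = 0" "frac t = t"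
    by (auto simp: floor_eq_iff frac_eq)
  then have "convergent_cf k t = 1 / convergent_cf j (1 / t)"
    using Suc by simp
  also have "\<dots> = Fract (int (cf_q (gauss t) j)) (int (cf_q t (Suc j)))"
    by (simp add: convergent_cf_inverse[OF assms] Fract_of_int_quotient)
  finally show ?thesis
    using coprime_consecutive[OF assms, of j] cf_q_pos[OF assms, of "Suc j"] Suc
    by (simp add: cf_denom_def quotient_of_Fract normalize_coprime coprime_commute)
qed

lemma cf_past_eq:
  assumes "t \<in> unit_irrats"
  shows "cf_past t (Suc k) = cf_q t k / cf_q t (Suc k)"
proof (induction k)
  case 0
  then show ?case by simp
next
  case (Suc k)
  have pos: "0 < real (cf_q t k)" "0 < real (cf_q t (Suc k))" "0 < real (cf_q t (Suc (Suc k)))"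
    using cf_q_pos[OF assms] by (auto simp del: cf_q.simps)
  have "cf_past t (Suc (Suc k)) = 1 / (cf_digit t (Suc k) + cf_q t k / cf_q t (Suc k))"
    using Suc by simp
  also have "\<dots> = cf_q t (Suc k) / (cf_digit t (Suc k) * cf_q t (Suc k) + cf_q t k)"
    using pos by (simp add: field_simps del: cf_q.simps)
  finally show ?case by simp
qed

lemma cf_past_bounds:
  assumes "t \<in> unit_irrats"
  shows "0 \<le> cf_past t k" "cf_past t k \<le> 1"
proof -
  have "0 \<le> cf_past t k \<and> cf_past t k \<le> 1"
  proof (induction k)
    case (Suc k)
    then show ?case
      using cf_digit_ge1[OF assms, of k] by simp
  qed simp
  then show "0 \<le> cf_past t k" "cf_past t k \<le> 1" by auto
qed

section \<open>The approximation errors\<close>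

text \<open>The classical identity \<open>\<bar>q\<^sub>k t - p\<^sub>k\<bar> (q\<^bsub>k+1\<^esub> + q\<^sub>k x) = 1\<close>, where \<open>x\<close> is the tail behind
  \<open>a\<^bsub>k+1\<^esub>\<close>. It expresses the error by the digits on both sides of position \<open>k\<close>.\<close>

lemma cf_err_identity:
  assumes "t \<in> unit_irrats"
  shows "(cf_q t (Suc k) + cf_q t k * cf_tail t (Suc k)) * cf_err t k = 1"
proof (induction k)
  case 0
  show ?case
    using inverse_cf_tail[OF assms, of 0] cf_tail_bounds[OF assms, of 0]
    by (simp add: cf_err_def field_simps)
next
  case (Suc k)
  have "(cf_digit t (Suc k) + cf_tail t (Suc (Suc k))) * cf_tail t (Suc k) = 1"
    using inverse_cf_tail[OF assms, of "Suc k"] cf_tail_bounds[OF assms, of "Suc k"]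
    by (simp add: field_simps)
  moreover have "(cf_q t (Suc (Suc k)) + cf_q t (Suc k) * cf_tail t (Suc (Suc k))) * cf_tail t (Suc k)
      = cf_q t (Suc k) * ((cf_digit t (Suc k) + cf_tail t (Suc (Suc k))) * cf_tail t (Suc k))
        + cf_q t k * cf_tail t (Suc k)"
    by (simp add: algebra_simps)
  ultimately have "(cf_q t (Suc (Suc k)) + cf_q t (Suc k) * cf_tail t (Suc (Suc k))) * cf_tail t (Suc k)
      = cf_q t (Suc k) + cf_q t k * cf_tail t (Suc k)"
    by simp
  moreover have "cf_err t (Suc k) = cf_tail t (Suc k) * cf_err t k"
    by (simp add: cf_err_def mult.commute)
  ultimately show ?case
    using Suc by (metis mult.assoc)
qed

lemma cf_err_pos: "t \<in> unit_irrats \<Longrightarrow> 0 < cf_err t k"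
  by (simp add: cf_err_def prod_pos cf_tail_bounds)

lemma cf_err_gauss: "cf_err t (Suc k) = t * cf_err (gauss t) k"
  by (simp add: cf_err_def prod.atMost_Suc_shift cf_tail_gauss del: prod.atMost_Suc)

lemma abs_convergent_error:
  assumes "t \<in> unit_irrats"
  shows "\<bar>real (cf_q t (Suc k)) * t - real (cf_q (gauss t) k)\<bar> = cf_err t (Suc k)"
  using assms
proof (induction k arbitrary: t)
  case 0
  have "real (cf_digit t 0) * t - 1 = - (t * gauss t)"
    using inverse_cf_tail[OF 0, of 0] 0
    by (simp add: unit_irrats_def field_simps cf_tail_Suc)
  then show ?case
    using 0 gauss_unit_irrats[OF 0] by (simp add: cf_err_def unit_irrats_def cf_tail_Suc abs_mult)
next
  case (Suc k)
  let ?A = "real (cf_q (gauss t) (Suc k))" and ?B = "real (cf_q (gauss (gauss t)) k)"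
  have d: "real (cf_digit t 0) * t - 1 = - (t * gauss t)"
    using inverse_cf_tail[OF Suc.prems, of 0] Suc.prems
    by (simp add: unit_irrats_def field_simps cf_tail_Suc)
  have "real (cf_q t (Suc (Suc k))) * t - ?A = (real (cf_digit t 0) * t - 1) * ?A + t * ?B"
    by (simp only: cf_q_first_digit of_nat_add of_nat_mult) (simp add: algebra_simps)
  also have "\<dots> = - t * (?A * gauss t - ?B)"
    by (simp only: d) (simp add: algebra_simps)
  finally have "\<bar>real (cf_q t (Suc (Suc k))) * t - ?A\<bar> = t * \<bar>?A * gauss t - ?B\<bar>"
    using Suc.prems by (simp add: abs_mult unit_irrats_def del: cf_q.simps)
  then show ?case
    using Suc.IH[OF gauss_unit_irrats[OF Suc.prems]] cf_err_gauss[of t "Suc k"] by simp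
qed

lemma infdist_Ints:
  fixes x :: real
  assumes "\<bar>x - of_int n\<bar> \<le> 1 / 2"
  shows "infdist x \<int> = \<bar>x - of_int n\<bar>"
proof (rule antisym)
  show "infdist x \<int> \<le> \<bar>x - of_int n\<bar>"
    using infdist_le[of "of_int n" \<int> x] by (simp add: dist_real_def)
  have "\<bar>x - of_int n\<bar> \<le> dist x z" if int: "z \<in> \<int>" for z
  proof -
    obtain m where z: "z = of_int m"
      using int by (elim Ints_cases)
    show ?thesis
    proof (cases "m = n")
      case False
      then have "1 \<le> \<bar>m - n\<bar>"
        by linarith
      then have "real_of_int 1 \<le> of_int \<bar>m - n\<bar>"
        by (simp only: of_int_le_iff)
      then have "1 \<le> \<bar>real_of_int m - of_int n\<bar>"
        by simp
      then show ?thesis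
        using assms unfolding z dist_real_def by linarith
    qed (simp add: z dist_real_def)
  qed
  moreover have "(\<int> :: real set) \<noteq> {}"
    using Ints_0 by blast
  ultimately show "\<bar>x - of_int n\<bar> \<le> infdist x \<int>"
    by (auto simp: infdist_def intro!: cINF_greatest)
qed

lemma infdist_cf_q:
  assumes t: "t \<in> unit_irrats"
  shows "infdist (real (cf_q t (Suc k)) * t) \<int> = cf_err t (Suc k)"
proof -
  have "2 \<le> cf_q t (Suc (Suc k))"
    using cf_q_pos[OF t, of k] cf_q_pos[OF t, of "Suc k"] cf_digit_pos[OF t, of "Suc k"]
    by (metis One_nat_def Suc_leI add_mono cf_q.simps(3) mult_le_mono nat_mult_1 one_add_one)
  then have "2 \<le> real (cf_q t (Suc (Suc k)))"
    by linarith
  moreover have "0 \<le> cf_q t (Suc k) * cf_tail t (Suc (Suc k))"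
    using cf_tail_bounds[OF t, of "Suc (Suc k)"] by simp
  ultimately have "2 * cf_err t (Suc k) \<le>
      (cf_q t (Suc (Suc k)) + cf_q t (Suc k) * cf_tail t (Suc (Suc k))) * cf_err t (Suc k)"
    using cf_err_pos[OF t, of "Suc k"] by (intro mult_right_mono) linarith+
  then have "cf_err t (Suc k) \<le> 1 / 2"
    using cf_err_identity[OF t, of "Suc k"] by simp
  then show ?thesis
    using infdist_Ints[of "real (cf_q t (Suc k)) * t" "int (cf_q (gauss t) k)"]
      abs_convergent_error[OF t, of k] by (simp del: cf_q.simps)
qed

text \<open>The numbers in question, with the error of the convergent in place of the distance to the
  nearest integer; the error obeys identities for every \<open>k\<close>.\<close>

definition approx_real :: "int \<Rightarrow> real \<Rightarrow> nat \<Rightarrow> real" where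
  "approx_real m t k = cf_q t (nat (int k + m)) * cf_err t k"

lemma approx_real_nonneg: "t \<in> unit_irrats \<Longrightarrow> 0 \<le> approx_real m t k"
  using cf_err_pos[of t k] by (simp add: approx_real_def)

text \<open>For \<open>k = 0\<close> the two sides may differ: if \<open>t > 1/2\<close> then the integer nearest to \<open>q\<^sub>0 t = t\<close> is
  \<open>1\<close> and not \<open>p\<^sub>0 = 0\<close>.\<close>

lemma eventually_approx_seq:
  assumes "t \<in> unit_irrats"
  shows "\<forall>\<^sub>F k in sequentially. approx_seq m t k = ennreal (approx_real m t k)"
  using eventually_gt_at_top[of 0]
proof eventually_elim
  case (elim k)
  then obtain j where "k = Suc j"
    using gr0_implies_Suc by blast
  then show ?case
    using infdist_cf_q[OF assms, of j]
    by (simp add: approx_seq_def approx_real_def cf_denom_eq[OF assms] del: cf_q.simps)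
qed

text \<open>Here the two-sided nature of the problem shows: the value at \<open>k\<close> is made of the digit there
  and of the expansions that start on its left and on its right.\<close>

lemma approx_real_0:
  assumes "t \<in> unit_irrats"
  shows "approx_real 0 t k = 1 / (cf_digit t k + cf_past t k + cf_tail t (Suc k))"
proof -
  have q: "0 < real (cf_q t k)"
    using cf_q_pos[OF assms, of k] by simp
  have "cf_q t (Suc k) = (cf_digit t k + cf_past t k) * cf_q t k"
  proof (cases k)
    case (Suc j)
    then show ?thesis
      using cf_past_eq[OF assms, of j] q by (simp add: field_simps del: cf_q.simps(2) cf_past.simps)
  qed simp
  then have "(cf_digit t k + cf_past t k + cf_tail t (Suc k)) * (cf_q t k * cf_err t k) = 1"
    using cf_err_identity[OF assms, of k] by (simp add: algebra_simps)
  then show ?thesis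
    unfolding approx_real_def
    by (metis add.right_neutral mult.commute nat_int nonzero_mult_div_cancel_right mult_zero_right zero_neq_one)
qed

lemma approx_real_down:
  assumes "t \<in> unit_irrats" "0 < int k + m"
  shows "approx_real (m - 1) t k = approx_real m t k * cf_past t (nat (int k + m))"
proof -
  obtain j where j: "nat (int k + m) = Suc j" "nat (int k + (m - 1)) = j"
    using assms(2) by (metis Suc_nat_eq_nat_zadd1 add_diff_eq diff_add_cancel zle_diff1_eq
        add.commute zle_diff1_eq)
  have "0 < real (cf_q t (Suc j))"
    using cf_q_pos[OF assms(1), of "Suc j"] by (simp del: cf_q.simps)
  then show ?thesis
    by (simp add: approx_real_def j cf_past_eq[OF assms(1)] del: cf_past.simps cf_q.simps)
qed

lemma approx_real_up:
  assumes "t \<in> unit_irrats" "0 \<le> int k + m"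
  shows "approx_real (m + 1) t k = approx_real m t k *
    (cf_digit t (nat (int k + m)) + cf_past t (nat (int k + m)))"
proof -
  obtain j where j: "nat (int k + m) = j" "nat (int k + (m + 1)) = Suc j"
    using assms(2) by (metis Suc_nat_eq_nat_zadd1 add.assoc add.commute)
  have "approx_real m t k = approx_real (m + 1) t k * cf_past t (Suc j)"
    using approx_real_down[OF assms(1), of k "m + 1"] assms(2) j by simp
  moreover have "0 < cf_digit t j + cf_past t j"
    using cf_digit_ge1[OF assms(1), of j] cf_past_bounds[OF assms(1), of j] by linarith
  ultimately show ?thesis
    by (simp add: j)
qed

section \<open>Prescribing the digits\<close>

text \<open>A rational number runs out of digits, because every step of the Gauss map lowers the
  numerator.\<close>

lemma rational_tail_vanishes:
  assumes "0 < q"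
  shows "\<exists>k. cf_tail (real p / real q) k = 0"
  using assms
proof (induction p arbitrary: q rule: less_induct)
  case (less p)
  show ?case
  proof (cases "p = 0")
    case True
    then show ?thesis by (intro exI[of _ 0]) simp
  next
    case False
    have "real q = real (q div p) * real p + real (q mod p)"
      by (simp flip: of_nat_mult of_nat_add)
    then have "real q / real p = of_int (int (q div p)) + real (q mod p) / real p"
      using False by (simp add: field_simps)
    moreover have "frac (real (q mod p) / real p) = real (q mod p) / real p"
      using False by (auto simp: frac_eq)
    ultimately have "gauss (real p / real q) = real (q mod p) / real p"
      by (simp add: gauss_def frac_def del: of_int_of_nat_eq)
    moreover obtain k where "cf_tail (real (q mod p) / real p) k = 0"
      using less.IH[of "q mod p" p] False by auto
    ultimately show ?thesis
      using cf_tail_gauss by metis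
  qed
qed

text \<open>The closure of the set of numbers whose digits start with \<open>b 0, \<dots>, b (n - 1)\<close>. It
  contains rational endpoints, which buys compactness.\<close>

primrec cylinder :: "nat \<Rightarrow> (nat \<Rightarrow> nat) \<Rightarrow> real set" where
  "cylinder 0 b = {0..1}"
| "cylinder (Suc n) b = (\<lambda>x. 1 / (real (b 0) + x)) ` cylinder n (\<lambda>i. b (Suc i))"

lemma cylinder_Suc_subset:
  assumes "\<And>i. 0 < b i"
  shows "cylinder (Suc n) b \<subseteq> cylinder n b"
  using assms
proof (induction n arbitrary: b)
  case 0
  have "1 \<le> real (b 0)"
    using 0[of 0] by linarith
  then show ?case by auto
next
  case (Suc n)
  have "cylinder (Suc n) (\<lambda>i. b (Suc i)) \<subseteq> cylinder n (\<lambda>i. b (Suc i))"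
    by (rule Suc.IH) (rule Suc.prems)
  then show ?case
    by (subst (1 2) cylinder.simps(2)) (rule image_mono)
qed

lemma cylinder_antimono:
  assumes "\<And>i. 0 < b i" "m \<le> n"
  shows "cylinder n b \<subseteq> cylinder m b"
  using assms(2) by (rule lift_Suc_antimono_le[of "\<lambda>n. cylinder n b", rotated])
    (rule cylinder_Suc_subset, rule assms(1))

lemma compact_cylinder:
  assumes "\<And>i. 0 < b i"
  shows "compact (cylinder n b)"
  using assms
proof (induction n arbitrary: b)
  case (Suc n)
  have "cylinder n (\<lambda>i. b (Suc i)) \<subseteq> cylinder 0 (\<lambda>i. b (Suc i))"
    by (rule cylinder_antimono) (simp_all add: Suc.prems)
  then have "real (b 0) + x \<noteq> 0" if "x \<in> cylinder n (\<lambda>i. b (Suc i))" for x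
    using that Suc.prems[of 0] by fastforce
  moreover have "compact (cylinder n (\<lambda>i. b (Suc i)))"
    by (rule Suc.IH) (rule Suc.prems)
  ultimately show ?case
    by (auto intro!: compact_continuous_image continuous_intros)
qed simp

lemma cylinder_nonempty: "cylinder n b \<noteq> {}"
  by (induction n arbitrary: b) auto

text \<open>The branches of the inverse of the Gauss map are injective, so membership in all cylinders
  of a digit sequence passes to the Gauss image and the shifted sequence.\<close>

lemma cylinder_tail:
  assumes x: "\<And>n. x \<in> cylinder n b"
  shows "\<exists>y. x = 1 / (real (b 0) + y) \<and> (\<forall>n. y \<in> cylinder n (\<lambda>i. b (Suc i)))"
proof -
  have "1 / x - b 0 \<in> cylinder n (\<lambda>i. b (Suc i))" for n
  proof -
    obtain y where "y \<in> cylinder n (\<lambda>i. b (Suc i))" "x = 1 / (real (b 0) + y)"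
      using x[of "Suc n"] by auto
    then show ?thesis by simp
  qed
  moreover have "x = 1 / (real (b 0) + (1 / x - real (b 0)))"
    by simp
  ultimately show ?thesis by blast
qed

lemma cylinder_gauss:
  assumes b: "\<And>i. 0 < b i" and x: "\<And>n. x \<in> cylinder n b"
  shows "0 < x" "x < 1" "cf_digit x 0 = b 0" "\<And>n. gauss x \<in> cylinder n (\<lambda>i. b (Suc i))"
proof -
  have range: "0 < z" if c: "\<And>i. 0 < c i" and z: "\<And>n. z \<in> cylinder n c" for z c
  proof -
    obtain y where y: "z = 1 / (real (c 0) + y)" "y \<in> cylinder 0 (\<lambda>i. c (Suc i))"
      using cylinder_tail[OF z] by blast
    moreover have "1 \<le> real (c 0)"
      using c[of 0] by linarith
    ultimately show ?thesis by auto
  qed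
  obtain y where y: "x = 1 / (real (b 0) + y)" "\<And>n. y \<in> cylinder n (\<lambda>i. b (Suc i))"
    using cylinder_tail[OF x] by blast
  have y_pos: "0 < y"
    by (rule range[of "\<lambda>i. b (Suc i)"]) (simp_all only: b y(2))
  obtain z where z: "y = 1 / (real (b 1) + z)" "\<And>n. z \<in> cylinder n (\<lambda>i. b (Suc (Suc i)))"
    using cylinder_tail[OF y(2)] by auto
  have "0 < z"
    by (rule range[of "\<lambda>i. b (Suc (Suc i))"]) (simp_all only: b z(2))
  moreover have "1 \<le> real (b 1)" "1 \<le> real (b 0)"
    using b[of 0] b[of 1] by linarith+
  ultimately have y1: "y < 1"
    using z by simp
  show "0 < x" "x < 1"
    using y_pos \<open>1 \<le> real (b 0)\<close> y(1) by simp_all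
  have inv: "1 / x = of_int (int (b 0)) + y"
    using y(1) by simp
  then have fl: "\<lfloor>1 / x\<rfloor> = int (b 0)"
    using y_pos y1 by linarith
  then show "cf_digit x 0 = b 0"
    by (simp add: cf_digit_def)
  have "gauss x = y"
    using inv fl by (simp add: gauss_def frac_def)
  then show "\<And>n. gauss x \<in> cylinder n (\<lambda>i. b (Suc i))"
    using y(2) by simp
qed

text \<open>A point in all cylinders exists by compactness. All its tails lie strictly
  between \<open>0\<close> and \<open>1\<close>, which gives the prescribed digits and irrationality.\<close>

proposition ex_unit_irrat_digits:
  assumes b: "\<And>i. 0 < b i"
  shows "\<exists>t\<in>unit_irrats. \<forall>k. cf_digit t k = b k"
proof -
  have "\<Inter> (range (\<lambda>n. cylinder n b)) \<noteq> {}"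
  proof (rule compact_nest)
    show "compact (cylinder n b)" for n
      by (rule compact_cylinder) (rule b)
    show "cylinder n b \<subseteq> cylinder m b" if "m \<le> n" for m n
      using that by (intro cylinder_antimono) (rule b)
  qed (rule cylinder_nonempty)
  then obtain t where t: "\<And>n. t \<in> cylinder n b"
    by blast
  have tails: "\<forall>n. cf_tail t k \<in> cylinder n (\<lambda>i. b (k + i))" for k
  proof (induction k)
    case (Suc k)
    then show ?case
      using cylinder_gauss(4)[of "\<lambda>i. b (k + i)" "cf_tail t k"] b by (simp add: cf_tail_Suc)
  qed (simp add: t)
  have digits: "cf_digit t k = b k" for k
    using cylinder_gauss(3)[of "\<lambda>i. b (k + i)" "cf_tail t k"] tails[of k] b
    by (simp add: cf_digit_def)
  have pos: "0 < cf_tail t k" "cf_tail t k < 1" for k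
    using cylinder_gauss(1,2)[of "\<lambda>i. b (k + i)" "cf_tail t k"] tails[of k] b by auto
  have "t \<notin> \<rat>"
  proof
    assume "t \<in> \<rat>"
    moreover have "0 < t"
      using pos[of 0] by simp
    ultimately obtain p q :: nat where "0 < q" "t = real p / real q"
      using Rats_abs_nat_div_natE[of t] by (metis abs_of_pos neq0_conv)
    then show False
      using rational_tail_vanishes[of q p] pos by (metis less_irrefl)
  qed
  then have "t \<in> unit_irrats"
    using pos[of 0] by (simp add: unit_irrats_def)
  then show ?thesis
    using digits by blast
qed

section \<open>Local dependence on the digits\<close>

text \<open>The equation \<open>k + j = l + i\<close> expresses without truncated subtraction that \<open>k\<close> lies relative to
  \<open>i\<close> as \<open>l\<close> relative to \<open>j\<close>.\<close>

definition same_window :: "nat \<Rightarrow> nat \<Rightarrow> real \<Rightarrow> nat \<Rightarrow> real \<Rightarrow> nat \<Rightarrow> bool" where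
  "same_window M N t i u j \<longleftrightarrow> t \<in> unit_irrats \<and> u \<in> unit_irrats \<and> N \<le> i \<and> N \<le> j \<and>
    (\<forall>k l. k + j = l + i \<longrightarrow> i \<le> k + N \<longrightarrow> k \<le> i + N \<longrightarrow>
      cf_digit t k = cf_digit u l \<and> cf_digit t k \<le> M)"

text \<open>The uniformity in the position and in the number is what the gluing argument needs. The
  bound \<open>M\<close> enters because \<open>q\<^bsub>k+1\<^esub> / q\<^sub>k\<close> is unbounded when digits are.\<close>

definition window_regular :: "(real \<Rightarrow> nat \<Rightarrow> real) \<Rightarrow> bool" where
  "window_regular g \<longleftrightarrow> (\<forall>M. \<exists>C N\<^sub>0. \<forall>N\<ge>N\<^sub>0. \<forall>t i u j. same_window M N t i u j \<longrightarrow>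
    \<bar>g t i\<bar> \<le> C \<and> \<bar>g t i - g u j\<bar> \<le> C / 2 ^ N)"

lemma same_windowD:
  assumes "same_window M N t i u j" "k + j = l + i" "i \<le> k + N" "k \<le> i + N"
  shows "cf_digit t k = cf_digit u l" "cf_digit t k \<le> M"
  using assms unfolding same_window_def by blast+

lemma window_regularE:
  assumes "window_regular g"
  obtains N\<^sub>0 C where
    "\<And>N t i u j. N\<^sub>0 \<le> N \<Longrightarrow> same_window M N t i u j \<Longrightarrow> \<bar>g t i\<bar> \<le> C"
    "\<And>N t i u j. N\<^sub>0 \<le> N \<Longrightarrow> same_window M N t i u j \<Longrightarrow> \<bar>g t i - g u j\<bar> \<le> C / 2 ^ N"
proof -
  have "\<exists>C N\<^sub>0. \<forall>N\<ge>N\<^sub>0. \<forall>t i u j. same_window M N t i u j \<longrightarrow>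
      \<bar>g t i\<bar> \<le> C \<and> \<bar>g t i - g u j\<bar> \<le> C / 2 ^ N"
    using assms unfolding window_regular_def by (rule spec)
  then obtain C N\<^sub>0 where *: "\<forall>N\<ge>N\<^sub>0. \<forall>t i u j. same_window M N t i u j \<longrightarrow>
      \<bar>g t i\<bar> \<le> C \<and> \<bar>g t i - g u j\<bar> \<le> C / 2 ^ N"
    by (elim exE)
  show ?thesis
    by (rule that[of N\<^sub>0 C]) (use * in \<open>simp_all\<close>)
qed

lemma same_window_sym: "same_window M N t i u j \<Longrightarrow> same_window M N u j t i"
proof -
  assume w: "same_window M N t i u j"
  have "cf_digit u k = cf_digit t l \<and> cf_digit u k \<le> M"
    if "k + i = l + j" "j \<le> k + N" "k \<le> j + N" for k l
  proof -
    have "l + j = k + i" "i \<le> l + N" "l \<le> i + N"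
      using that by linarith+
    then show ?thesis
      using same_windowD[OF w, of l k] by simp
  qed
  with w show ?thesis
    unfolding same_window_def by blast
qed

lemma same_window_shift:
  assumes "same_window M N t i u j" and "nat \<bar>c\<bar> \<le> N"
  shows "same_window M (N - nat \<bar>c\<bar>) t (nat (int i + c)) u (nat (int j + c))"
proof -
  have N: "N \<le> i" "N \<le> j"
    and tu: "t \<in> unit_irrats" "u \<in> unit_irrats"
    using assms(1) by (auto simp: same_window_def)
  show ?thesis
    unfolding same_window_def
  proof (intro conjI allI impI)
    show "N - nat \<bar>c\<bar> \<le> nat (int i + c)" "N - nat \<bar>c\<bar> \<le> nat (int j + c)"
      using N assms(2) by linarith+
    fix k l
    assume "k + nat (int j + c) = l + nat (int i + c)"
      "nat (int i + c) \<le> k + (N - nat \<bar>c\<bar>)" "k \<le> nat (int i + c) + (N - nat \<bar>c\<bar>)"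
    then have "k + j = l + i" "i \<le> k + N" "k \<le> i + N"
      using N assms(2) by linarith+
    then show "cf_digit t k = cf_digit u l" "cf_digit t k \<le> M"
      using same_windowD[OF assms(1)] by blast+
  qed (fact tu)+
qed

text \<open>A single step \<open>x \<mapsto> 1 / (a + x)\<close> need not be a contraction, as \<open>a = 1\<close> and \<open>x = 0\<close> show; two
  steps are one.\<close>

lemma two_step_contraction:
  fixes a b x y :: real
  assumes "1 \<le> a" "1 \<le> b" "0 \<le> x" "0 \<le> y"
  shows "\<bar>1 / (a + 1 / (b + x)) - 1 / (a + 1 / (b + y))\<bar> \<le> \<bar>x - y\<bar> / 4"
proof -
  define P where "P = a * (b + x) + 1"
  define Q where "Q = a * (b + y) + 1"
  have "1 * 1 \<le> a * (b + x)" "1 * 1 \<le> a * (b + y)"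
    using assms by (intro mult_mono; simp)+
  then have PQ: "2 \<le> P" "2 \<le> Q"
    by (simp_all add: P_def Q_def)
  have eq: "1 / (a + 1 / (b + x)) = (b + x) / P" "1 / (a + 1 / (b + y)) = (b + y) / Q"
    using assms by (simp_all add: P_def Q_def field_simps)
  have "(b + x) / P - (b + y) / Q = ((b + x) * Q - (b + y) * P) / (P * Q)"
    using PQ by (simp add: field_simps)
  also have "(b + x) * Q - (b + y) * P = x - y"
    by (simp add: P_def Q_def algebra_simps)
  finally have "\<bar>1 / (a + 1 / (b + x)) - 1 / (a + 1 / (b + y))\<bar> = \<bar>x - y\<bar> / (P * Q)"
    using PQ by (simp add: eq abs_mult)
  also have "2 * 2 \<le> P * Q"
    using PQ by (intro mult_mono) auto
  then have "\<bar>x - y\<bar> / (P * Q) \<le> \<bar>x - y\<bar> / 4"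
    by (intro divide_left_mono) auto
  finally show ?thesis .
qed

lemma cf_tail_close:
  assumes t: "t \<in> unit_irrats" and u: "u \<in> unit_irrats"
    and "\<And>d. d < N \<Longrightarrow> cf_digit t (i + d) = cf_digit u (j + d)"
  shows "\<bar>cf_tail t i - cf_tail u j\<bar> \<le> 2 / 2 ^ N"
  using assms(3)
proof (induction N arbitrary: i j rule: induct_nat_012)
  case (ge2 n)
  have d: "cf_digit t i = cf_digit u j" "cf_digit t (Suc i) = cf_digit u (Suc j)"
    using ge2.prems[of 0] ge2.prems[of 1] by simp_all
  have "cf_tail t i = 1 / (cf_digit u j + 1 / (cf_digit u (Suc j) + cf_tail t (Suc (Suc i))))"
    "cf_tail u j = 1 / (cf_digit u j + 1 / (cf_digit u (Suc j) + cf_tail u (Suc (Suc j))))"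
    using cf_tail_eq[OF t, of i] cf_tail_eq[OF t, of "Suc i"] cf_tail_eq[OF u, of j]
      cf_tail_eq[OF u, of "Suc j"] d by simp_all
  then have "\<bar>cf_tail t i - cf_tail u j\<bar>
      \<le> \<bar>cf_tail t (Suc (Suc i)) - cf_tail u (Suc (Suc j))\<bar> / 4"
    using two_step_contraction[of "cf_digit u j" "cf_digit u (Suc j)"]
      cf_digit_ge1[OF u] cf_tail_bounds[OF t] cf_tail_bounds[OF u] by (simp add: less_imp_le)
  moreover have "\<bar>cf_tail t (Suc (Suc i)) - cf_tail u (Suc (Suc j))\<bar> \<le> 2 / 2 ^ n"
    using ge2.prems[of "Suc (Suc _)"] by (intro ge2.IH) simp
  ultimately show ?case by simp
next
  case 0
  show ?case
    using cf_tail_bounds[OF t, of i] cf_tail_bounds[OF u, of j] by simp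
next
  case 1
  show ?case
    using cf_tail_bounds[OF t, of i] cf_tail_bounds[OF u, of j] by simp
qed

lemma cf_past_close:
  assumes t: "t \<in> unit_irrats" and u: "u \<in> unit_irrats"
    and "N \<le> i" "N \<le> j" "\<And>k l. k + j = l + i \<Longrightarrow> i \<le> k + N \<Longrightarrow> k < i \<Longrightarrow> cf_digit t k = cf_digit u l"
  shows "\<bar>cf_past t i - cf_past u j\<bar> \<le> 2 / 2 ^ N"
  using assms(3-5)
proof (induction N arbitrary: i j rule: induct_nat_012)
  case (ge2 n)
  obtain i' j' where ij: "i = Suc (Suc i')" "j = Suc (Suc j')"
    using ge2.prems(1,2) by (metis Suc_le_D Suc_le_mono)
  have d: "cf_digit t i' = cf_digit u j'" "cf_digit t (Suc i') = cf_digit u (Suc j')"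
    using ge2.prems(3)[of i' j'] ge2.prems(3)[of "Suc i'" "Suc j'"] by (simp_all add: ij)
  have "\<bar>cf_past t i - cf_past u j\<bar> \<le> \<bar>cf_past t i' - cf_past u j'\<bar> / 4"
    using two_step_contraction[of "cf_digit u (Suc j')" "cf_digit u j'" "cf_past t i'" "cf_past u j'"]
      cf_digit_ge1[OF u] cf_past_bounds[OF t] cf_past_bounds[OF u] by (simp add: ij d)
  moreover have "\<bar>cf_past t i' - cf_past u j'\<bar> \<le> 2 / 2 ^ n"
    using ge2.prems by (intro ge2.IH) (simp_all add: ij)
  ultimately show ?case by simp
next
  case 0
  show ?case
    using cf_past_bounds[OF t, of i] cf_past_bounds[OF u, of j] by simp
next
  case 1
  show ?case
    using cf_past_bounds[OF t, of i] cf_past_bounds[OF u, of j] by simp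
qed

lemma same_window_past:
  "same_window M N t i u j \<Longrightarrow> \<bar>cf_past t i - cf_past u j\<bar> \<le> 2 / 2 ^ N"
  by (rule cf_past_close) (auto simp: same_window_def)

lemma window_regular_mult:
  assumes "window_regular g" "window_regular h"
  shows "window_regular (\<lambda>t k. g t k * h t k)"
  unfolding window_regular_def
proof
  fix M
  obtain N\<^sub>0 C where g: "\<And>N t i u j. N\<^sub>0 \<le> N \<Longrightarrow> same_window M N t i u j \<Longrightarrow> \<bar>g t i\<bar> \<le> C"
    "\<And>N t i u j. N\<^sub>0 \<le> N \<Longrightarrow> same_window M N t i u j \<Longrightarrow> \<bar>g t i - g u j\<bar> \<le> C / 2 ^ N"
    using window_regularE[OF assms(1), of M] by blast
  obtain N\<^sub>1 D where h: "\<And>N t i u j. N\<^sub>1 \<le> N \<Longrightarrow> same_window M N t i u j \<Longrightarrow> \<bar>h t i\<bar> \<le> D"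
    "\<And>N t i u j. N\<^sub>1 \<le> N \<Longrightarrow> same_window M N t i u j \<Longrightarrow> \<bar>h t i - h u j\<bar> \<le> D / 2 ^ N"
    using window_regularE[OF assms(2), of M] by blast
  have "\<bar>g t i * h t i\<bar> \<le> 2 * C * D \<and> \<bar>g t i * h t i - g u j * h u j\<bar> \<le> 2 * C * D / 2 ^ N"
    if N: "max N\<^sub>0 N\<^sub>1 \<le> N" and w: "same_window M N t i u j" for N t i u j
  proof
    have G: "\<bar>g t i\<bar> \<le> C" "\<bar>g t i - g u j\<bar> \<le> C / 2 ^ N" "\<bar>g u j\<bar> \<le> C"
      and H: "\<bar>h t i\<bar> \<le> D" "\<bar>h t i - h u j\<bar> \<le> D / 2 ^ N"
      using g[OF _ w] h[OF _ w] g(1)[OF _ same_window_sym[OF w]] N by auto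
    have nonneg: "0 \<le> C" "0 \<le> D"
      using G H by linarith+
    have "\<bar>g t i * h t i\<bar> \<le> C * D"
      unfolding abs_mult using G H nonneg by (intro mult_mono) auto
    moreover have "0 \<le> C * D"
      using nonneg by simp
    ultimately show "\<bar>g t i * h t i\<bar> \<le> 2 * C * D"
      by linarith
    have "\<bar>g t i * h t i - g u j * h u j\<bar> = \<bar>(g t i - g u j) * h t i + g u j * (h t i - h u j)\<bar>"
      by (simp add: algebra_simps)
    also have "\<dots> \<le> \<bar>g t i - g u j\<bar> * \<bar>h t i\<bar> + \<bar>g u j\<bar> * \<bar>h t i - h u j\<bar>"
      by (metis abs_mult abs_triangle_ineq)
    also have "\<dots> \<le> (C / 2 ^ N) * D + C * (D / 2 ^ N)"
      using G H nonneg by (intro add_mono mult_mono) auto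
    finally show "\<bar>g t i * h t i - g u j * h u j\<bar> \<le> 2 * C * D / 2 ^ N"
      by (simp add: field_simps)
  qed
  then show "\<exists>C N\<^sub>0. \<forall>N\<ge>N\<^sub>0. \<forall>t i u j. same_window M N t i u j \<longrightarrow>
      \<bar>g t i * h t i\<bar> \<le> C \<and> \<bar>g t i * h t i - g u j * h u j\<bar> \<le> C / 2 ^ N"
    by blast
qed

lemma window_regular_cong:
  assumes "window_regular g" and eq: "\<And>t k. t \<in> unit_irrats \<Longrightarrow> K \<le> k \<Longrightarrow> g t k = h t k"
  shows "window_regular h"
  unfolding window_regular_def
proof
  fix M
  obtain N\<^sub>0 C where g: "\<And>N t i u j. N\<^sub>0 \<le> N \<Longrightarrow> same_window M N t i u j \<Longrightarrow> \<bar>g t i\<bar> \<le> C"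
    "\<And>N t i u j. N\<^sub>0 \<le> N \<Longrightarrow> same_window M N t i u j \<Longrightarrow> \<bar>g t i - g u j\<bar> \<le> C / 2 ^ N"
    using window_regularE[OF assms(1), of M] by blast
  have "\<bar>h t i\<bar> \<le> C \<and> \<bar>h t i - h u j\<bar> \<le> C / 2 ^ N"
    if N: "max N\<^sub>0 K \<le> N" and w: "same_window M N t i u j" for N t i u j
  proof -
    have "t \<in> unit_irrats" "u \<in> unit_irrats" "K \<le> i" "K \<le> j"
      using w N by (auto simp: same_window_def)
    then have "g t i = h t i" "g u j = h u j"
      using eq by blast+
    then show ?thesis
      using g(1)[of N t i u j] g(2)[of N t i u j] N w by simp
  qed
  then show "\<exists>C N\<^sub>0. \<forall>N\<ge>N\<^sub>0. \<forall>t i u j. same_window M N t i u j \<longrightarrow>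
      \<bar>h t i\<bar> \<le> C \<and> \<bar>h t i - h u j\<bar> \<le> C / 2 ^ N"
    by blast
qed

lemma window_regular_shift:
  assumes "window_regular g"
  shows "window_regular (\<lambda>t k. g t (nat (int k + c)))"
  unfolding window_regular_def
proof
  fix M
  obtain N\<^sub>0 C where g: "\<And>N t i u j. N\<^sub>0 \<le> N \<Longrightarrow> same_window M N t i u j \<Longrightarrow> \<bar>g t i\<bar> \<le> C"
    "\<And>N t i u j. N\<^sub>0 \<le> N \<Longrightarrow> same_window M N t i u j \<Longrightarrow> \<bar>g t i - g u j\<bar> \<le> C / 2 ^ N"
    using window_regularE[OF assms, of M] by blast
  let ?c = "nat \<bar>c\<bar>"
  have "\<bar>g t (nat (int i + c))\<bar> \<le> C * 2 ^ ?c \<and>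
      \<bar>g t (nat (int i + c)) - g u (nat (int j + c))\<bar> \<le> C * 2 ^ ?c / 2 ^ N"
    if N: "N\<^sub>0 + ?c \<le> N" and w: "same_window M N t i u j" for N t i u j
  proof
    let ?G = "g t (nat (int i + c))"
    have *: "\<bar>?G\<bar> \<le> C" "\<bar>?G - g u (nat (int j + c))\<bar> \<le> C / 2 ^ (N - ?c)"
      using g[OF _ same_window_shift[OF w]] N by auto
    then have "0 \<le> C"
      by linarith
    then have "C * 1 \<le> C * 2 ^ ?c"
      by (intro mult_left_mono) auto
    with * show "\<bar>?G\<bar> \<le> C * 2 ^ ?c"
      by linarith
    have "(2::real) ^ N = 2 ^ (N - ?c) * 2 ^ ?c"
      using N by (simp flip: power_add)
    with * show "\<bar>?G - g u (nat (int j + c))\<bar> \<le> C * 2 ^ ?c / 2 ^ N"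
      by simp
  qed
  then show "\<exists>C N\<^sub>0. \<forall>N\<ge>N\<^sub>0. \<forall>t i u j. same_window M N t i u j \<longrightarrow>
      \<bar>g t (nat (int i + c))\<bar> \<le> C \<and> \<bar>g t (nat (int i + c)) - g u (nat (int j + c))\<bar> \<le> C / 2 ^ N"
    by blast
qed

lemma window_regular_past: "window_regular cf_past"
  unfolding window_regular_def
proof (intro allI exI impI)
  fix M N t i u j
  assume w: "same_window M N t i u j"
  then have "t \<in> unit_irrats"
    by (simp add: same_window_def)
  then show "\<bar>cf_past t i\<bar> \<le> 2 \<and> \<bar>cf_past t i - cf_past u j\<bar> \<le> 2 / 2 ^ N"
    using same_window_past[OF w] cf_past_bounds[of t i] by auto
qed

lemma window_regular_digit_past: "window_regular (\<lambda>t k. cf_digit t k + cf_past t k)"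
  unfolding window_regular_def
proof (intro allI exI impI)
  fix M N t i u j
  assume w: "same_window M N t i u j"
  then have t: "t \<in> unit_irrats"
    by (simp add: same_window_def)
  have d: "cf_digit t i = cf_digit u j" "cf_digit t i \<le> M"
    using same_windowD[OF w, of i j] by simp_all
  then have "real (cf_digit t i) \<le> M"
    by simp
  moreover have "2 / 2 ^ N \<le> (real M + 2) / 2 ^ N"
    by (intro divide_right_mono) auto
  ultimately show "\<bar>real (cf_digit t i) + cf_past t i\<bar> \<le> real M + 2 \<and>
      \<bar>real (cf_digit t i) + cf_past t i - (real (cf_digit u j) + cf_past u j)\<bar> \<le> (real M + 2) / 2 ^ N"
    using same_window_past[OF w] cf_past_bounds[OF t, of i] d(1) by simp
qed

lemma window_regular_approx_0: "window_regular (approx_real 0)"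
  unfolding window_regular_def
proof (intro allI exI impI)
  fix M N t i u j
  assume "1 \<le> N" and w: "same_window M N t i u j"
  have t: "t \<in> unit_irrats" and u: "u \<in> unit_irrats" and d: "cf_digit t i = cf_digit u j"
    using w same_windowD[OF w, of i j] by (auto simp: same_window_def)
  have tail: "\<bar>cf_tail t (Suc i) - cf_tail u (Suc j)\<bar> \<le> 2 / 2 ^ N"
    by (intro cf_tail_close t u same_windowD(1)[OF w]) auto
  define x where "x = cf_digit u j + cf_past t i + cf_tail t (Suc i)"
  define y where "y = cf_digit u j + cf_past u j + cf_tail u (Suc j)"
  have xy: "1 \<le> x" "1 \<le> y"
    using cf_digit_ge1[OF u, of j] cf_past_bounds[OF t, of i] cf_past_bounds[OF u, of j]
      cf_tail_bounds[OF t, of "Suc i"] cf_tail_bounds[OF u, of "Suc j"]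
    unfolding x_def y_def by linarith+
  have eq: "approx_real 0 t i = 1 / x" "approx_real 0 u j = 1 / y"
    by (simp_all add: approx_real_0 t u d x_def y_def)
  have "1 * 1 \<le> x * y"
    using xy by (intro mult_mono) auto
  have "\<bar>1 / x - 1 / y\<bar> = \<bar>x - y\<bar> / (x * y)"
    using xy by (simp add: divide_simps abs_minus_commute)
  also have "\<dots> \<le> \<bar>x - y\<bar> / 1"
    using \<open>1 * 1 \<le> x * y\<close> by (intro divide_left_mono) auto
  also have "\<bar>x - y\<bar> / 1 \<le> 4 / 2 ^ N"
    unfolding div_by_1 using same_window_past[OF w] tail unfolding x_def y_def by linarith
  finally have "\<bar>1 / x - 1 / y\<bar> \<le> 4 / 2 ^ N" .
  moreover have "0 \<le> 1 / x" "1 / x \<le> 1"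
    using xy by simp_all
  ultimately show "\<bar>approx_real 0 t i\<bar> \<le> 4 \<and> \<bar>approx_real 0 t i - approx_real 0 u j\<bar> \<le> 4 / 2 ^ N"
    by (simp add: eq)
qed

text \<open>Going from \<open>m\<close> to \<open>m + 1\<close> or \<open>m - 1\<close> multiplies by a quotient of consecutive denominators,
  which is itself determined by the digits in a window up to an exponentially small error.\<close>

proposition window_regular_approx: "window_regular (approx_real m)"
proof (induction m rule: int_induct[of _ 0])
  case base
  show ?case by (rule window_regular_approx_0)
next
  case (step1 m)
  have "window_regular (\<lambda>t k. approx_real m t k *
      (cf_digit t (nat (int k + m)) + cf_past t (nat (int k + m))))"
    by (rule window_regular_mult[OF step1(2) window_regular_shift[OF window_regular_digit_past]])
  then show ?case
    by (rule window_regular_cong[where K = 0]) (simp add: approx_real_up step1(1))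
next
  case (step2 m)
  have "window_regular (\<lambda>t k. approx_real m t k * cf_past t (nat (int k + m)))"
    by (rule window_regular_mult[OF step2(2) window_regular_shift[OF window_regular_past]])
  \<comment> \<open>For \<open>k + m \<le> 0\<close> the index truncates to \<open>0\<close> on both sides and the recursion fails.\<close>
  then show ?case
    by (rule window_regular_cong[where K = "nat (1 - m)"]) (simp add: approx_real_down)
qed

section \<open>Gluing digit sequences\<close>

text \<open>Sequential compactness of the space of two-sided sequences over a finite alphabet.\<close>

lemma ex_convergent_windows:
  fixes w :: "nat \<Rightarrow> int \<Rightarrow> nat"
  assumes "\<And>n d. w n d \<le> M"
  shows "\<exists>\<phi> \<theta>. strict_mono (\<phi> :: nat \<Rightarrow> nat) \<and>
    (\<forall>r::nat. \<forall>\<^sub>F n in sequentially. \<forall>d. \<bar>d\<bar> \<le> int r \<longrightarrow> w (\<phi> n) d = \<theta> d)"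
proof -
  have "compactin (product_topology (\<lambda>_::int. euclidean) UNIV) (PiE UNIV (\<lambda>_. {..M}))"
    by (subst compactin_PiE) (simp add: finite_imp_compact)
  then have "compact (PiE (UNIV :: int set) (\<lambda>_. {..M}))"
    by (simp add: euclidean_product_topology)
  then have "seq_compact (PiE (UNIV :: int set) (\<lambda>_. {..M}))"
    by (rule compact_imp_seq_compact)
  moreover have "\<forall>n. w n \<in> PiE UNIV (\<lambda>_. {..M})"
    using assms by auto
  ultimately obtain \<theta> \<phi> where \<phi>: "strict_mono (\<phi> :: nat \<Rightarrow> nat)" and lim: "(w \<circ> \<phi>) \<longlonglongrightarrow> \<theta>"
    by (elim seq_compactE) auto
  have "\<forall>\<^sub>F n in sequentially. w (\<phi> n) d = \<theta> d" for d
  proof -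
    have "(\<lambda>n. (w \<circ> \<phi>) n d) \<longlonglongrightarrow> \<theta> d"
      by (rule continuous_on_tendsto_compose[OF continuous_on_product_coordinates lim]) auto
    then show ?thesis
      by (simp add: tendsto_discrete)
  qed
  then have ball: "\<forall>\<^sub>F n in sequentially. \<forall>d\<in>{-int r..int r}. w (\<phi> n) d = \<theta> d" for r :: nat
    by (intro eventually_ball_finite) auto
  have "\<forall>\<^sub>F n in sequentially. \<forall>d. \<bar>d\<bar> \<le> int r \<longrightarrow> w (\<phi> n) d = \<theta> d" for r :: nat
    using ball[of r] by (rule eventually_mono) (simp add: Ball_def abs_le_iff minus_le_iff)
  with \<phi> show ?thesis by blast
qed

text \<open>The blocks \<open>a r\<close> restricted to \<open>{s r..<t r}\<close> are concatenated; block \<open>r\<close> starts at \<open>p r\<close>. Since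
  the surroundings of every cut are copies of one two-sided sequence \<open>\<theta>\<close>, a window that reaches
  across a cut still looks as if it lay inside a single \<open>a r\<close>.\<close>

lemma glue_blocks:
  fixes a :: "nat \<Rightarrow> nat \<Rightarrow> nat" and \<theta> :: "int \<Rightarrow> nat"
  assumes s: "\<And>r. r \<le> s r" and t: "\<And>r. s r + r < t r"
    and ws: "\<And>r d. \<bar>d\<bar> \<le> int r \<Longrightarrow> a r (nat (int (s r) + d)) = \<theta> d"
    and wt: "\<And>r d. \<bar>d\<bar> \<le> int r \<Longrightarrow> a r (nat (int (t r) + d)) = \<theta> d"
  shows "\<exists>b p. (\<forall>k. \<exists>r l. s r \<le> l \<and> b k = a r l) \<and> p 0 = 0 \<and> strict_mono (p :: nat \<Rightarrow> nat) \<and>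
    (\<forall>r i k l. p (Suc r) \<le> i \<longrightarrow> i < p (Suc (Suc r)) \<longrightarrow> k + s (Suc r) = l + p (Suc r) \<longrightarrow>
      i \<le> k + r \<longrightarrow> k \<le> i + r \<longrightarrow> b k = a (Suc r) l)"
proof -
  define p where "p r = (\<Sum>q<r. t q - s q)" for r
  have p_Suc: "p (Suc r) = p r + (t r - s r)" for r
    by (simp add: p_def)
  have len: "r < t r - s r" for r
    using t[of r] by linarith
  have mono: "strict_mono p"
  proof (subst strict_mono_Suc_iff, intro allI)
    show "p n < p (Suc n)" for n
      using len[of n] p_Suc[of n] by linarith
  qed
  define block where "block k = (LEAST r. k < p (Suc r))" for k
  define b where "b k = a (block k) (s (block k) + (k - p (block k)))" for k
  have block: "block k = r" if "p r \<le> k" "k < p (Suc r)" for k r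
    unfolding block_def
  proof (rule Least_equality)
    fix q
    assume "k < p (Suc q)"
    then have "p r < p (Suc q)"
      using that by simp
    then show "r \<le> q"
      using mono by (simp add: strict_mono_less)
  qed (use that in simp)
  have b: "b k = a r (s r + (k - p r))" if "p r \<le> k" "k < p (Suc r)" for k r
    using block[OF that] by (simp add: b_def)
  have "b k = a (Suc r) l"
    if i: "p (Suc r) \<le> i" "i < p (Suc (Suc r))" and kl: "k + s (Suc r) = l + p (Suc r)"
      and k: "i \<le> k + r" "k \<le> i + r" for r i k l
  proof -
    consider "k < p (Suc r)" | "p (Suc r) \<le> k" "k < p (Suc (Suc r))" | "p (Suc (Suc r)) \<le> k"
      by linarith
    then show ?thesis
    proof cases
      case 1
      \<comment> \<open>Left of the block: \<open>k\<close> lies in the block before, which ends as \<open>\<theta>\<close> prescribes.\<close>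
      have "p r \<le> k"
        using 1 i k len[of r] p_Suc[of r] by linarith
      then have "b k = a r (s r + (k - p r))"
        using 1 by (rule b)
      also have "s r + (k - p r) = nat (int (t r) + (int k - int (p (Suc r))))"
        using \<open>p r \<le> k\<close> 1 len[of r] p_Suc[of r] by linarith
      also have "a r \<dots> = \<theta> (int k - int (p (Suc r)))"
        using 1 i k by (intro wt) linarith
      also have "\<dots> = a (Suc r) (nat (int (s (Suc r)) + (int k - int (p (Suc r)))))"
        using 1 i k by (intro ws[symmetric]) linarith
      also have "nat (int (s (Suc r)) + (int k - int (p (Suc r)))) = l"
        using kl by linarith
      finally show ?thesis .
    next
      case 2
      then have "b k = a (Suc r) (s (Suc r) + (k - p (Suc r)))"
        by (rule b)
      also have "s (Suc r) + (k - p (Suc r)) = l"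
        using kl 2 by linarith
      finally show ?thesis .
    next
      case 3
      \<comment> \<open>Right of the block: the next block begins as \<open>\<theta>\<close> prescribes.\<close>
      let ?q = "Suc (Suc r)"
      have "k < p (Suc ?q)"
        using 3 i k len[of ?q] p_Suc[of ?q] by linarith
      with 3 have "b k = a ?q (s ?q + (k - p ?q))"
        by (rule b)
      also have "s ?q + (k - p ?q) = nat (int (s ?q) + (int k - int (p ?q)))"
        using 3 by linarith
      also have "a ?q \<dots> = \<theta> (int k - int (p ?q))"
        using 3 i k by (intro ws) linarith
      also have "\<dots> = a (Suc r) (nat (int (t (Suc r)) + (int k - int (p ?q))))"
        using 3 i k by (intro wt[symmetric]) linarith
      also have "nat (int (t (Suc r)) + (int k - int (p ?q))) = l"
        using kl 3 len[of "Suc r"] p_Suc[of "Suc r"] by linarith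
      finally show ?thesis .
    qed
  qed
  moreover have "\<exists>r l. s r \<le> l \<and> b k = a r l" for k
    unfolding b_def using le_add1 by blast
  moreover have "p 0 = 0"
    by (simp add: p_def)
  ultimately show ?thesis
    using mono by blast
qed

section \<open>Limits of extremal values\<close>

text \<open>For \<open>\<sigma> = 1\<close> the real number \<open>v\<close> is the upper limit of \<open>x\<close>, and for \<open>\<sigma> = -1\<close> the lower limit:
  a cluster value that eventually bounds \<open>x\<close> up to any \<open>\<epsilon>\<close>. With the sign as a parameter the gluing
  argument covers both.\<close>

definition extremal_cluster :: "real \<Rightarrow> (nat \<Rightarrow> real) \<Rightarrow> real \<Rightarrow> bool" where
  "extremal_cluster \<sigma> x v \<longleftrightarrow> (\<forall>\<epsilon>>0. (\<forall>\<^sub>F k in sequentially. \<sigma> * x k < \<sigma> * v + \<epsilon>) \<and>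
    (\<exists>\<^sub>F k in sequentially. \<bar>x k - v\<bar> < \<epsilon>))"

lemma limsup_ennreal_iff:
  fixes x :: "nat \<Rightarrow> real"
  assumes x: "\<And>k. 0 \<le> x k" and v: "0 \<le> v"
  shows "limsup (\<lambda>k. ennreal (x k)) = ennreal v \<longleftrightarrow> extremal_cluster 1 x v"
proof
  assume lim: "limsup (\<lambda>k. ennreal (x k)) = ennreal v"
  have above: "\<forall>\<^sub>F k in sequentially. x k < v + \<epsilon>" if "0 < \<epsilon>" for \<epsilon>
  proof -
    have "limsup (\<lambda>k. ennreal (x k)) < ennreal (v + \<epsilon>)"
      using that v by (simp add: lim ennreal_less_iff)
    then have "\<forall>\<^sub>F k in sequentially. ennreal (x k) < ennreal (v + \<epsilon>)"
      by (rule Limsup_lessD)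
    then show ?thesis
      by eventually_elim (use x in \<open>simp add: ennreal_less_iff\<close>)
  qed
  moreover have "\<exists>\<^sub>F k in sequentially. \<bar>x k - v\<bar> < \<epsilon>" if "0 < \<epsilon>" for \<epsilon>
  proof (rule ccontr)
    assume "\<not> ?thesis"
    then have "\<forall>\<^sub>F k in sequentially. \<not> \<bar>x k - v\<bar> < \<epsilon>"
      by (simp add: not_frequently)
    then have ev: "\<forall>\<^sub>F k in sequentially. x k \<le> v - \<epsilon>"
      using above[OF that] by eventually_elim linarith
    then have "0 \<le> v - \<epsilon>"
      using x by (metis eventually_happens order_trans sequentially_bot)
    from ev have "\<forall>\<^sub>F k in sequentially. ennreal (x k) \<le> ennreal (v - \<epsilon>)"
      by eventually_elim (rule ennreal_leI)
    then have "ennreal v \<le> ennreal (v - \<epsilon>)"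
      using lim Limsup_bounded by metis
    then show False
      using \<open>0 \<le> v - \<epsilon>\<close> that by simp
  qed
  ultimately show "extremal_cluster 1 x v"
    by (simp add: extremal_cluster_def)
next
  assume ec: "extremal_cluster 1 x v"
  show "limsup (\<lambda>k. ennreal (x k)) = ennreal v"
  proof (rule antisym)
    show "limsup (\<lambda>k. ennreal (x k)) \<le> ennreal v"
    proof (rule ennreal_le_epsilon)
      fix \<epsilon> :: real
      assume "0 < \<epsilon>"
      then have "\<forall>\<^sub>F k in sequentially. x k < v + \<epsilon>"
        using ec by (simp add: extremal_cluster_def)
      then have "\<forall>\<^sub>F k in sequentially. ennreal (x k) \<le> ennreal (v + \<epsilon>)"
        by eventually_elim (simp add: ennreal_leI)
      then have "limsup (\<lambda>k. ennreal (x k)) \<le> ennreal (v + \<epsilon>)"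
        by (rule Limsup_bounded)
      then show "limsup (\<lambda>k. ennreal (x k)) \<le> ennreal v + ennreal \<epsilon>"
        using v \<open>0 < \<epsilon>\<close> by simp
    qed
    show "ennreal v \<le> limsup (\<lambda>k. ennreal (x k))"
    proof (rule ccontr)
      assume "\<not> ?thesis"
      then have less: "limsup (\<lambda>k. ennreal (x k)) < ennreal v"
        by simp
      then obtain c where c: "0 \<le> c" "limsup (\<lambda>k. ennreal (x k)) = ennreal c" "c < v"
        by (cases "limsup (\<lambda>k. ennreal (x k))") (auto simp: ennreal_less_iff)
      define d where "d = (c + v) / 2"
      have d: "c < d" "d < v"
        using c by (auto simp: d_def)
      then have "limsup (\<lambda>k. ennreal (x k)) < ennreal d"
        using c by (simp add: ennreal_less_iff)
      then have "\<forall>\<^sub>F k in sequentially. ennreal (x k) < ennreal d"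
        by (rule Limsup_lessD)
      then have "\<forall>\<^sub>F k in sequentially. \<not> \<bar>x k - v\<bar> < v - d"
        by eventually_elim (use x in \<open>simp add: ennreal_less_iff\<close>)
      then show False
        using ec d by (simp add: extremal_cluster_def frequently_def)
    qed
  qed
qed

lemma liminf_ennreal_iff:
  fixes x :: "nat \<Rightarrow> real"
  assumes x: "\<And>k. 0 \<le> x k" and v: "0 \<le> v"
  shows "liminf (\<lambda>k. ennreal (x k)) = ennreal v \<longleftrightarrow> extremal_cluster (-1) x v"
proof
  assume lim: "liminf (\<lambda>k. ennreal (x k)) = ennreal v"
  have below: "\<forall>\<^sub>F k in sequentially. v - \<epsilon> < x k" if "0 < \<epsilon>" for \<epsilon>
  proof (cases "v - \<epsilon> < 0")
    case True
    then have "v - \<epsilon> < x k" for k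
      using x[of k] by linarith
    then show ?thesis by simp
  next
    case False
    then have "ennreal (v - \<epsilon>) < liminf (\<lambda>k. ennreal (x k))"
      using that v by (simp add: lim ennreal_less_iff)
    then have "\<forall>\<^sub>F k in sequentially. ennreal (v - \<epsilon>) < ennreal (x k)"
      by (rule less_LiminfD)
    then show ?thesis
      by eventually_elim (use False in \<open>simp add: ennreal_less_iff\<close>)
  qed
  moreover have "\<exists>\<^sub>F k in sequentially. \<bar>x k - v\<bar> < \<epsilon>" if "0 < \<epsilon>" for \<epsilon>
  proof (rule ccontr)
    assume "\<not> ?thesis"
    then have "\<forall>\<^sub>F k in sequentially. \<not> \<bar>x k - v\<bar> < \<epsilon>"
      by (simp add: not_frequently)
    then have "\<forall>\<^sub>F k in sequentially. ennreal (v + \<epsilon>) \<le> ennreal (x k)"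
      using below[OF that] by eventually_elim (rule ennreal_leI, linarith)
    then have "ennreal (v + \<epsilon>) \<le> ennreal v"
      using lim Liminf_bounded by metis
    then show False
      using v that by simp
  qed
  ultimately show "extremal_cluster (-1) x v"
    by (simp add: extremal_cluster_def algebra_simps)
next
  assume ec: "extremal_cluster (-1) x v"
  have below: "\<forall>\<^sub>F k in sequentially. v - \<epsilon> < x k" if "0 < \<epsilon>" for \<epsilon>
  proof -
    have "\<forall>\<^sub>F k in sequentially. - 1 * x k < - 1 * v + \<epsilon>"
      using ec that by (simp only: extremal_cluster_def)
    then show ?thesis
      by eventually_elim linarith
  qed
  show "liminf (\<lambda>k. ennreal (x k)) = ennreal v"
  proof (rule antisym)
    show "liminf (\<lambda>k. ennreal (x k)) \<le> ennreal v"
    proof (rule ennreal_le_epsilon)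
      fix \<epsilon> :: real
      assume "0 < \<epsilon>"
      have "liminf (\<lambda>k. ennreal (x k)) \<le> ennreal (v + \<epsilon>)"
      proof (rule ccontr)
        assume "\<not> ?thesis"
        then have "ennreal (v + \<epsilon>) < liminf (\<lambda>k. ennreal (x k))"
          by simp
        then have "\<forall>\<^sub>F k in sequentially. ennreal (v + \<epsilon>) < ennreal (x k)"
          by (rule less_LiminfD)
        then have "\<forall>\<^sub>F k in sequentially. \<not> \<bar>x k - v\<bar> < \<epsilon>"
          by eventually_elim (use v \<open>0 < \<epsilon>\<close> in \<open>simp add: ennreal_less_iff del: ennreal_plus\<close>)
        then show False
          using ec \<open>0 < \<epsilon>\<close> by (simp add: extremal_cluster_def frequently_def)
      qed
      then show "liminf (\<lambda>k. ennreal (x k)) \<le> ennreal v + ennreal \<epsilon>"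
        using v \<open>0 < \<epsilon>\<close> by simp
    qed
    show "ennreal v \<le> liminf (\<lambda>k. ennreal (x k))"
    proof (rule ennreal_le_epsilon)
      fix \<epsilon> :: real
      assume "0 < \<epsilon>"
      have "\<forall>\<^sub>F k in sequentially. ennreal (v - \<epsilon>) \<le> ennreal (x k)"
        using below[OF \<open>0 < \<epsilon>\<close>] by eventually_elim (simp add: ennreal_leI)
      then have "ennreal (v - \<epsilon>) \<le> liminf (\<lambda>k. ennreal (x k))"
        by (rule Liminf_bounded)
      moreover have "ennreal v \<le> ennreal (v - \<epsilon>) + ennreal \<epsilon>"
        using \<open>0 < \<epsilon>\<close> v
        by (cases "0 \<le> v - \<epsilon>") (simp_all add: ennreal_neg ennreal_leI flip: ennreal_plus)
      ultimately show "ennreal v \<le> liminf (\<lambda>k. ennreal (x k)) + ennreal \<epsilon>"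
        by (meson add_right_mono order_trans)
    qed
  qed
qed

text \<open>Among the positions at which \<open>x\<close> is close to its cluster value \<open>v\<close>, the surroundings
  themselves accumulate somewhere.\<close>

lemma ex_recurrent_window:
  fixes a :: "nat \<Rightarrow> nat" and x :: "nat \<Rightarrow> real"
  assumes x: "\<And>\<epsilon>. 0 < \<epsilon> \<Longrightarrow> \<exists>\<^sub>F k in sequentially. \<bar>x k - v\<bar> < \<epsilon>"
    and a: "\<forall>\<^sub>F k in sequentially. a k \<le> M"
  shows "\<exists>\<theta>. (\<forall>d. \<theta> d \<le> M) \<and> (\<forall>(r::nat) \<epsilon> K. 0 < \<epsilon> \<longrightarrow>
    (\<exists>k\<ge>K. \<bar>x k - v\<bar> < \<epsilon> \<and> (\<forall>d. \<bar>d\<bar> \<le> int r \<longrightarrow> a (nat (int k + d)) = \<theta> d)))"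
proof -
  have "\<exists>k\<ge>n. \<bar>x k - v\<bar> < 1 / Suc n" for n
    using x[of "1 / Suc n"] unfolding frequently_sequentially by simp
  then obtain \<kappa> where \<kappa>: "\<And>n. n \<le> \<kappa> n" "\<And>n. \<bar>x (\<kappa> n) - v\<bar> < 1 / Suc n"
    by metis
  obtain \<phi> \<theta> where \<phi>: "strict_mono (\<phi> :: nat \<Rightarrow> nat)" and \<theta>: "\<And>r::nat. \<forall>\<^sub>F n in sequentially. \<forall>d.
      \<bar>d\<bar> \<le> int r \<longrightarrow> min M (a (nat (int (\<kappa> (\<phi> n)) + d))) = \<theta> d"
    using ex_convergent_windows[of "\<lambda>n d. min M (a (nat (int (\<kappa> n) + d)))" M] by auto
  have "\<theta> d \<le> M" for d
  proof -
    have "\<exists>n. \<forall>e. \<bar>e\<bar> \<le> int (nat \<bar>d\<bar>) \<longrightarrow> min M (a (nat (int (\<kappa> (\<phi> n)) + e))) = \<theta> e"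
      using eventually_happens[OF \<theta>[of "nat \<bar>d\<bar>"]] by simp
    then obtain n where "min M (a (nat (int (\<kappa> (\<phi> n)) + d))) = \<theta> d"
      by auto
    then show ?thesis
      by (metis min.cobounded1)
  qed
  moreover have "\<exists>k\<ge>K. \<bar>x k - v\<bar> < \<epsilon> \<and> (\<forall>d. \<bar>d\<bar> \<le> int r \<longrightarrow> a (nat (int k + d)) = \<theta> d)"
    if "0 < \<epsilon>" for r :: nat and \<epsilon> K
  proof -
    obtain L where L: "\<And>k. L \<le> k \<Longrightarrow> a k \<le> M"
      using a by (auto simp: eventually_sequentially)
    obtain R where R: "1 / Suc R < \<epsilon>"
      using nat_approx_posE[OF \<open>0 < \<epsilon>\<close>] .
    obtain n where n: "K + L + r + R \<le> n"
      "\<And>d. \<bar>d\<bar> \<le> int r \<Longrightarrow> min M (a (nat (int (\<kappa> (\<phi> n)) + d))) = \<theta> d"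
      using eventually_happens[OF eventually_conj[OF \<theta> eventually_ge_at_top]] by fastforce
    define k where "k = \<kappa> (\<phi> n)"
    have "n \<le> \<phi> n" "\<phi> n \<le> k"
      using \<phi> \<kappa>(1) by (auto simp: k_def strict_mono_imp_increasing)
    then have k: "K + L + r + R \<le> k" "R \<le> \<phi> n"
      using n(1) by linarith+
    have "1 / Suc (\<phi> n) \<le> 1 / Suc R"
      using k(2) by (intro divide_left_mono) auto
    then have "\<bar>x k - v\<bar> < \<epsilon>"
      using \<kappa>(2)[of "\<phi> n"] R by (simp add: k_def)
    moreover have "a (nat (int k + d)) = \<theta> d" if "\<bar>d\<bar> \<le> int r" for d
    proof -
      have "L \<le> nat (int k + d)"
        using k(1) that by linarith
      then show ?thesis
        using L n(2)[OF that] by (simp add: k_def min_absorb2)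
    qed
    ultimately show ?thesis
      using k(1) by (intro exI[of _ k]) auto
  qed
  ultimately show ?thesis
    by blast
qed

text \<open>The bound \<open>M\<close> gives the compactness that yields a common model \<open>\<theta>\<close> for all cuts, and the
  uniform estimate on windows. The \<open>\<alpha> n\<close> themselves need not converge to the new number: only
  ever longer pieces of them recur in it.\<close>

theorem extremal_cluster_limit:
  fixes g :: "real \<Rightarrow> nat \<Rightarrow> real" and \<alpha> :: "nat \<Rightarrow> real"
  assumes g: "window_regular g" and \<sigma>: "\<bar>\<sigma>\<bar> = 1"
    and \<alpha>: "\<And>n. \<alpha> n \<in> unit_irrats" and ec: "\<And>n. extremal_cluster \<sigma> (g (\<alpha> n)) (v n)"
    and bdd: "\<And>n. \<forall>\<^sub>F k in sequentially. cf_digit (\<alpha> n) k \<le> M" and lim: "v \<longlonglongrightarrow> w"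
  shows "\<exists>\<beta>\<in>unit_irrats. extremal_cluster \<sigma> (g \<beta>) w"
proof -
  have "\<exists>\<theta>. (\<forall>d. \<theta> d \<le> M) \<and> (\<forall>(r::nat) \<epsilon> K. 0 < \<epsilon> \<longrightarrow> (\<exists>k\<ge>K. \<bar>g (\<alpha> n) k - v n\<bar> < \<epsilon> \<and>
      (\<forall>d. \<bar>d\<bar> \<le> int r \<longrightarrow> cf_digit (\<alpha> n) (nat (int k + d)) = \<theta> d)))" for n
    using ec[of n] bdd[of n] unfolding extremal_cluster_def
    by (intro ex_recurrent_window) blast+
  then obtain \<Theta> where \<Theta>_le: "\<And>n d. \<Theta> n d \<le> M" and \<Theta>: "\<And>n (r::nat) \<epsilon> K. 0 < \<epsilon> \<Longrightarrow>
      \<exists>k\<ge>K. \<bar>g (\<alpha> n) k - v n\<bar> < \<epsilon> \<and>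
        (\<forall>d. \<bar>d\<bar> \<le> int r \<longrightarrow> cf_digit (\<alpha> n) (nat (int k + d)) = \<Theta> n d)"
    by metis
  obtain \<phi> \<theta> where \<phi>: "strict_mono (\<phi> :: nat \<Rightarrow> nat)"
    and \<theta>: "\<And>r::nat. \<forall>\<^sub>F n in sequentially. \<forall>d. \<bar>d\<bar> \<le> int r \<longrightarrow> \<Theta> (\<phi> n) d = \<theta> d"
    using ex_convergent_windows[of \<Theta> M] \<Theta>_le by auto
  \<comment> \<open>Block \<open>r\<close> is cut out of \<open>\<alpha> n\<close> between \<open>s\<close> and \<open>t\<close>. It starts at a position whose value is close
    to \<open>v n\<close>, so far out that no later value passes \<open>v n\<close> by much in direction \<open>\<sigma>\<close> and that the digits, also those
    in the window reaching to the left of \<open>s\<close>, are at most \<open>M\<close>.\<close>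
  define good where "good r n s t \<longleftrightarrow> r \<le> n \<and> r \<le> s \<and> s + r < t
      \<and> \<bar>g (\<alpha> n) s - v n\<bar> < 1 / Suc r
      \<and> (\<forall>k\<ge>s. \<sigma> * g (\<alpha> n) k < \<sigma> * v n + 1 / Suc r)
      \<and> (\<forall>k. s \<le> k + r \<longrightarrow> cf_digit (\<alpha> n) k \<le> M)
      \<and> (\<forall>d. \<bar>d\<bar> \<le> int r \<longrightarrow> cf_digit (\<alpha> n) (nat (int s + d)) = \<theta> d
                          \<and> cf_digit (\<alpha> n) (nat (int t + d)) = \<theta> d)" for r n s t
  have "\<exists>n s t. good r n s t" for r
  proof -
    obtain m where m: "r \<le> m" "\<And>d. \<bar>d\<bar> \<le> int r \<Longrightarrow> \<Theta> (\<phi> m) d = \<theta> d"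
      using eventually_happens[OF eventually_conj[OF \<theta> eventually_ge_at_top]] by fastforce
    define n where "n = \<phi> m"
    have "r \<le> n"
      using m(1) strict_mono_imp_increasing[OF \<phi>, of m] by (simp add: n_def)
    have "\<forall>\<^sub>F k in sequentially. \<sigma> * g (\<alpha> n) k < \<sigma> * v n + 1 / Suc r \<and> cf_digit (\<alpha> n) k \<le> M"
      using ec[of n] bdd[of n] unfolding extremal_cluster_def by (intro eventually_conj) auto
    then obtain K where K: "\<And>k. K \<le> k \<Longrightarrow> \<sigma> * g (\<alpha> n) k < \<sigma> * v n + 1 / Suc r"
      "\<And>k. K \<le> k \<Longrightarrow> cf_digit (\<alpha> n) k \<le> M"
      unfolding eventually_sequentially by blast
    obtain s where s: "K + r \<le> s" "\<bar>g (\<alpha> n) s - v n\<bar> < 1 / Suc r"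
      "\<And>d. \<bar>d\<bar> \<le> int r \<Longrightarrow> cf_digit (\<alpha> n) (nat (int s + d)) = \<Theta> n d"
      using \<Theta>[of "1 / Suc r" "K + r" n r] by auto
    obtain t where t: "s + r + 1 \<le> t"
      "\<And>d. \<bar>d\<bar> \<le> int r \<Longrightarrow> cf_digit (\<alpha> n) (nat (int t + d)) = \<Theta> n d"
      using \<Theta>[of 1 "s + r + 1" n r] by auto
    have "good r n s t"
      unfolding good_def using \<open>r \<le> n\<close> s t m(2) K by (auto simp: n_def)
    then show ?thesis by blast
  qed
  then obtain N s t where good: "\<And>r. good r (N r) (s r) (t r)"
    by metis
  have good_index: "r \<le> N r" and good_near: "\<bar>g (\<alpha> (N r)) (s r) - v (N r)\<bar> < 1 / Suc r" for r
    using good[of r] unfolding good_def by blast+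
  have good_upper: "\<sigma> * g (\<alpha> (N r)) k < \<sigma> * v (N r) + 1 / Suc r" if "s r \<le> k" for r k
    using good[of r] that unfolding good_def by blast
  have "\<exists>b p. (\<forall>k. \<exists>r l. s r \<le> l \<and> b k = cf_digit (\<alpha> (N r)) l) \<and> p 0 = 0 \<and> strict_mono p \<and>
    (\<forall>r i k l. p (Suc r) \<le> i \<longrightarrow> i < p (Suc (Suc r)) \<longrightarrow> k + s (Suc r) = l + p (Suc r) \<longrightarrow>
      i \<le> k + r \<longrightarrow> k \<le> i + r \<longrightarrow> b k = cf_digit (\<alpha> (N (Suc r))) l)"
    by (rule glue_blocks[where t = t and \<theta> = \<theta>]) (use good in \<open>simp_all add: good_def\<close>)
  then obtain b p where origin: "\<forall>k. \<exists>r l. s r \<le> l \<and> b k = cf_digit (\<alpha> (N r)) l"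
    and p0: "p 0 = 0" and p_mono: "strict_mono p"
    and blocks: "\<forall>r i k l. p (Suc r) \<le> i \<longrightarrow> i < p (Suc (Suc r)) \<longrightarrow> k + s (Suc r) = l + p (Suc r) \<longrightarrow>
      i \<le> k + r \<longrightarrow> k \<le> i + r \<longrightarrow> b k = cf_digit (\<alpha> (N (Suc r))) l"
    by (elim exE conjE)
  have b: "b k = cf_digit (\<alpha> (N (Suc r))) l"
    if "p (Suc r) \<le> i" "i < p (Suc (Suc r))" "k + s (Suc r) = l + p (Suc r)"
      "i \<le> k + r" "k \<le> i + r" for r i k l
    using blocks that by blast
  have b_pos: "0 < b k" for k
    using origin cf_digit_pos[OF \<alpha>] by metis
  then obtain \<beta> where \<beta>: "\<beta> \<in> unit_irrats" "\<And>k. cf_digit \<beta> k = b k"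
    using ex_unit_irrat_digits[of b, OF b_pos] by blast
  have window: "same_window M r (\<alpha> (N (Suc r))) (s (Suc r) + (i - p (Suc r))) \<beta> i"
    if i: "p (Suc r) \<le> i" "i < p (Suc (Suc r))" for r i
    unfolding same_window_def
  proof (intro conjI allI impI)
    show "r \<le> s (Suc r) + (i - p (Suc r))"
      using good[of "Suc r"] by (simp add: good_def)
    show "r \<le> i"
      using i strict_mono_imp_increasing[OF p_mono, of "Suc r"] by linarith
    fix k l
    assume kl: "k + i = l + (s (Suc r) + (i - p (Suc r)))"
      "s (Suc r) + (i - p (Suc r)) \<le> k + r" "k \<le> s (Suc r) + (i - p (Suc r)) + r"
    have "b l = cf_digit (\<alpha> (N (Suc r))) k"
      by (rule b[OF i]) (use kl i in linarith)+
    then show "cf_digit (\<alpha> (N (Suc r))) k = cf_digit \<beta> l"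
      by (simp add: \<beta>(2))
    show "cf_digit (\<alpha> (N (Suc r))) k \<le> M"
    proof -
      have "s (Suc r) \<le> k + Suc r"
        using kl(2) by linarith
      then show ?thesis
        using good[of "Suc r"] unfolding good_def by blast
    qed
  qed (rule \<alpha> \<beta>(1))+
  have "\<exists>N\<^sub>0 C. \<forall>r\<ge>N\<^sub>0. \<forall>t i u j. same_window M r t i u j \<longrightarrow> \<bar>g t i - g u j\<bar> \<le> C / 2 ^ r"
    by (rule window_regularE[OF g, of M]) (intro exI allI impI)
  then obtain N\<^sub>0 C where C: "\<And>r t i u j. N\<^sub>0 \<le> r \<Longrightarrow> same_window M r t i u j \<Longrightarrow>
      \<bar>g t i - g u j\<bar> \<le> C / 2 ^ r"
    by metis
  \<comment> \<open>The deviation from \<open>w\<close> within block \<open>r + 1\<close>: the distance of \<open>v\<close> to its limit, the tolerance in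
    \<open>good\<close>, and the effect of digits outside the window of radius \<open>r\<close>.\<close>
  define e where "e r = \<bar>v (N (Suc r)) - w\<bar> + 1 / Suc (Suc r) + C / 2 ^ r" for r
  have close: "\<bar>g \<beta> i - g (\<alpha> (N (Suc r))) (s (Suc r) + (i - p (Suc r)))\<bar> \<le> C / 2 ^ r"
    if "N\<^sub>0 \<le> r" "p (Suc r) \<le> i" "i < p (Suc (Suc r))" for r i
    using C[OF that(1) window[OF that(2,3)]] by (simp add: abs_minus_commute)
  have \<sigma>_le: "\<sigma> * z \<le> \<bar>z\<bar>" for z
    using abs_ge_self[of "\<sigma> * z"] by (simp only: abs_mult \<sigma> mult_1_left)
  have upper: "\<sigma> * g \<beta> i < \<sigma> * w + e r"
    if r: "N\<^sub>0 \<le> r" and i: "p (Suc r) \<le> i" "i < p (Suc (Suc r))" for r i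
  proof -
    let ?y = "g (\<alpha> (N (Suc r))) (s (Suc r) + (i - p (Suc r)))"
    have "\<sigma> * ?y < \<sigma> * v (N (Suc r)) + 1 / Suc (Suc r)"
      by (rule good_upper) (rule le_add1)
    moreover have "\<sigma> * (g \<beta> i - ?y) \<le> C / 2 ^ r"
      using close[OF that] \<sigma>_le order_trans by blast
    moreover have "\<sigma> * (v (N (Suc r)) - w) \<le> \<bar>v (N (Suc r)) - w\<bar>"
      by (rule \<sigma>_le)
    ultimately show ?thesis
      unfolding e_def right_diff_distrib by linarith
  qed
  have near: "\<bar>g \<beta> (p (Suc r)) - w\<bar> < e r" if r: "N\<^sub>0 \<le> r" for r
  proof -
    have "\<bar>g (\<alpha> (N (Suc r))) (s (Suc r)) - v (N (Suc r))\<bar> < 1 / Suc (Suc r)"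
      by (rule good_near)
    moreover have "\<bar>g \<beta> (p (Suc r)) - g (\<alpha> (N (Suc r))) (s (Suc r))\<bar> \<le> C / 2 ^ r"
      using close[OF r, of "p (Suc r)"] strict_mono_less[OF p_mono] by simp
    ultimately show ?thesis
      unfolding e_def by linarith
  qed
  have "filterlim (\<lambda>r. N (Suc r)) at_top sequentially"
  proof (rule filterlim_at_top_mono[OF filterlim_ident])
    show "\<forall>\<^sub>F r in sequentially. r \<le> N (Suc r)"
      using good_index by (intro always_eventually allI) (rule Suc_leD)
  qed
  then have "(\<lambda>r. v (N (Suc r))) \<longlonglongrightarrow> w"
    by (rule filterlim_compose[OF lim])
  then have v_lim: "(\<lambda>r. \<bar>v (N (Suc r)) - w\<bar>) \<longlonglongrightarrow> 0"
    by (intro tendsto_rabs_zero) (simp add: LIM_zero)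
  moreover have "(\<lambda>r. 1 / real (Suc (Suc r))) \<longlonglongrightarrow> 0"
    using LIMSEQ_Suc[OF LIMSEQ_inverse_real_of_nat] by (simp add: inverse_eq_divide)
  moreover have "(\<lambda>r. C / 2 ^ r) \<longlonglongrightarrow> 0"
    by (rule LIMSEQ_divide_realpow_zero) simp
  ultimately have e: "e \<longlonglongrightarrow> 0"
    unfolding e_def by (intro tendsto_add_zero)
  have "extremal_cluster \<sigma> (g \<beta>) w"
    unfolding extremal_cluster_def
  proof (intro allI impI conjI)
    fix \<epsilon> :: real
    assume "0 < \<epsilon>"
    then have "\<forall>\<^sub>F r in sequentially. e r < \<epsilon> \<and> N\<^sub>0 \<le> r"
      using order_tendstoD(2)[OF e] by (intro eventually_conj eventually_ge_at_top) auto
    then obtain R where "\<forall>r\<ge>R. e r < \<epsilon> \<and> N\<^sub>0 \<le> r"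
      unfolding eventually_sequentially by (elim exE)
    then have R: "e r < \<epsilon>" "N\<^sub>0 \<le> r" if "R \<le> r" for r
      using that by auto
    show "\<forall>\<^sub>F k in sequentially. \<sigma> * g \<beta> k < \<sigma> * w + \<epsilon>"
      unfolding eventually_sequentially
    proof (intro exI allI impI)
      fix i
      assume i: "p (Suc R) \<le> i"
      have "i < p (Suc i)"
        using strict_mono_imp_increasing[OF p_mono, of "Suc i"] by linarith
      moreover have "\<not> i < p 0"
        by (simp add: p0)
      ultimately obtain q where "\<forall>j\<le>q. \<not> i < p j" "i < p (q + 1)"
        using ex_least_nat_less[of "\<lambda>q. i < p q" "Suc i"] by auto
      then have q: "p q \<le> i" "i < p (Suc q)"
        by (simp_all add: not_less)
      then have "p (Suc R) < p (Suc q)"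
        using i by linarith
      then have "Suc R < Suc q"
        by (simp only: strict_mono_less[OF p_mono])
      then have "Suc R \<le> q"
        by (rule less_Suc_eq_le[THEN iffD1])
      then obtain r where "q = Suc r" "R \<le> r"
        by (metis Suc_le_D Suc_le_mono)
      then show "\<sigma> * g \<beta> i < \<sigma> * w + \<epsilon>"
        using upper[of r i] q R[of r] by fastforce
    qed
    show "\<exists>\<^sub>F k in sequentially. \<bar>g \<beta> k - w\<bar> < \<epsilon>"
      unfolding frequently_sequentially
    proof
      fix K
      have "K \<le> p (Suc (R + K))"
        using strict_mono_imp_increasing[OF p_mono, of "Suc (R + K)"] by linarith
      moreover have "\<bar>g \<beta> (p (Suc (R + K))) - w\<bar> < \<epsilon>"
        using near[of "R + K"] R[of "R + K"] by simp
      ultimately show "\<exists>k\<ge>K. \<bar>g \<beta> k - w\<bar> < \<epsilon>"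
        by blast
    qed
  qed
  then show ?thesis
    using \<beta>(1) by blast
qed

section \<open>Large digits force the extreme value\<close>

lemma cf_q_mono:
  assumes "t \<in> unit_irrats" "i \<le> j"
  shows "cf_q t i \<le> cf_q t j"
proof -
  have "cf_q t k \<le> cf_q t (Suc k)" for k
  proof (cases k)
    case 0
    then show ?thesis
      using cf_digit_pos[OF assms(1), of 0] by simp
  next
    case (Suc n)
    have "cf_q t (Suc n) \<le> cf_digit t (Suc n) * cf_q t (Suc n)"
      using cf_digit_pos[OF assms(1), of "Suc n"] by (cases "cf_digit t (Suc n)") auto
    then show ?thesis
      unfolding Suc cf_q.simps(3) by (rule trans_le_add1)
  qed
  then show ?thesis
    using lift_Suc_mono_le[of "cf_q t"] assms(2) by blast
qed

lemma approx_real_1: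
  assumes "t \<in> unit_irrats"
  shows "approx_real 1 t k =
    (cf_digit t k + cf_past t k) / (cf_digit t k + cf_past t k + cf_tail t (Suc k))"
  using approx_real_up[OF assms, of k 0] by (simp add: approx_real_0[OF assms])

lemma approx_real_1_bounds:
  assumes t: "t \<in> unit_irrats"
  shows "approx_real 1 t k \<le> 1" "1 - 1 / cf_digit t k \<le> approx_real 1 t k" "1 / 2 \<le> approx_real 1 t k"
proof -
  define z where "z = cf_tail t (Suc k)"
  define c where "c = cf_digit t k + cf_past t k"
  have z: "0 < z" "z < 1" and d: "1 \<le> real (cf_digit t k)" and c: "real (cf_digit t k) \<le> c" "1 \<le> c"
    using cf_tail_bounds[OF t] cf_digit_ge1[OF t, of k] cf_past_bounds[OF t, of k]
    by (auto simp: z_def c_def)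
  have eq: "approx_real 1 t k = c / (c + z)"
    by (simp add: approx_real_1[OF t] c_def z_def)
  show "approx_real 1 t k \<le> 1"
    unfolding eq using z c by simp
  show "1 / 2 \<le> approx_real 1 t k"
    unfolding eq using z c by (simp add: field_simps)
  have "c / (c + z) = 1 - z / (c + z)"
    using z c by (simp add: field_simps)
  moreover have "z / (c + z) \<le> 1 / cf_digit t k"
    using z c d by (intro frac_le) auto
  ultimately show "1 - 1 / cf_digit t k \<le> approx_real 1 t k"
    unfolding eq by linarith
qed

text \<open>The next estimate, together with \<open>1 - 1 / a\<^bsub>k+1\<^esub> \<le> q\<^bsub>k+1\<^esub> \<parallel>q\<^sub>k t\<parallel>\<close> above and the bound for \<open>m \<ge> 2\<close>
  below, serves twice: it shows that growing digits produce the extreme value, and that values away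
  from it keep the digits bounded.\<close>

lemma approx_real_nonpos_le:
  assumes t: "t \<in> unit_irrats" and m: "m \<le> 0"
  shows "approx_real m t k \<le> 1 / cf_digit t k"
proof -
  have "real (cf_q t (nat (int k + m))) \<le> real (cf_q t k)"
    using cf_q_mono[OF t, of "nat (int k + m)" k] m by simp
  then have "approx_real m t k \<le> approx_real 0 t k"
    unfolding approx_real_def using cf_err_pos[OF t, of k] by (simp add: mult_right_mono)
  also have "\<dots> \<le> 1 / cf_digit t k"
    unfolding approx_real_0[OF t]
    using cf_digit_ge1[OF t, of k] cf_past_bounds[OF t, of k] cf_tail_bounds[OF t, of "Suc k"]
    by (intro divide_left_mono mult_pos_pos) linarith+
  finally show ?thesis .
qed

lemma approx_real_ge_digit:
  assumes t: "t \<in> unit_irrats" and m: "2 \<le> m"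
  shows "cf_digit t (k + nat (m - 1)) / 2 \<le> approx_real m t k"
proof -
  define j where "j = k + nat (m - 1)"
  have "Suc k \<le> j" and j: "nat (int k + m) = Suc j"
    using m by (auto simp: j_def)
  then obtain i where i: "j = Suc i"
    using Suc_le_D by blast
  have "cf_digit t j * cf_q t (Suc k) \<le> cf_digit t j * cf_q t j"
    using cf_q_mono[OF t \<open>Suc k \<le> j\<close>] by (intro mult_left_mono) auto
  also have "\<dots> \<le> cf_q t (Suc j)"
    by (simp add: i)
  finally have "real (cf_digit t j) * real (cf_q t (Suc k)) \<le> real (cf_q t (Suc j))"
    by (metis of_nat_le_iff of_nat_mult)
  then have "cf_digit t j * cf_q t (Suc k) * cf_err t k \<le> cf_q t (Suc j) * cf_err t k"
    using cf_err_pos[OF t, of k] by (intro mult_right_mono) auto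
  moreover have "approx_real 1 t k = cf_q t (Suc k) * cf_err t k"
  proof -
    have "nat (int k + 1) = Suc k"
      by simp
    then show ?thesis
      by (simp only: approx_real_def)
  qed
  ultimately have "cf_digit t j * approx_real 1 t k \<le> approx_real m t k"
    by (simp only: approx_real_def[of m] j of_nat_mult mult.assoc)
  moreover have "cf_digit t j * (1 / 2) \<le> cf_digit t j * approx_real 1 t k"
    using approx_real_1_bounds(3)[OF t, of k] by (intro mult_left_mono) auto
  ultimately show ?thesis
    by (simp add: j_def)
qed

lemma approx_real_le_1:
  assumes "t \<in> unit_irrats" "m \<le> 1"
  shows "approx_real m t k \<le> 1"
proof -
  have "real (cf_q t (nat (int k + m))) \<le> real (cf_q t (Suc k))"
    using cf_q_mono[OF assms(1), of "nat (int k + m)" "Suc k"] assms(2) by simp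
  then have "approx_real m t k \<le> approx_real 1 t k"
    unfolding approx_real_def using cf_err_pos[OF assms(1), of k]
    by (simp add: mult_right_mono nat_add_distrib del: cf_q.simps)
  then show ?thesis
    using approx_real_1_bounds(1)[OF assms(1), of k] by linarith
qed

section \<open>Closedness\<close>

lemma unit_irrats_eq: "{0..1} - \<rat> = unit_irrats"
proof -
  have "x \<noteq> 0 \<and> x \<noteq> 1" if "x \<notin> \<rat>" for x :: real
    using that by auto
  then show ?thesis
    by (auto simp: unit_irrats_def less_le)
qed

lemma limsup_approx_seq:
  assumes "t \<in> unit_irrats"
  shows "limsup (approx_seq m t) = limsup (\<lambda>k. ennreal (approx_real m t k))"
  by (rule Limsup_eq) (rule eventually_approx_seq[OF assms])

lemma liminf_approx_seq:
  assumes "t \<in> unit_irrats"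
  shows "liminf (approx_seq m t) = liminf (\<lambda>k. ennreal (approx_real m t k))"
  by (rule Liminf_eq) (rule eventually_approx_seq[OF assms])

text \<open>The exceptional value \<open>E\<close> is the one that unbounded digits may produce. Away from it, digits
  are bounded uniformly, and the gluing theorem applies.\<close>

theorem closed_extremal_values:
  fixes F :: "(nat \<Rightarrow> ennreal) \<Rightarrow> ennreal" and E :: ennreal and m :: int
  defines "X \<equiv> (\<lambda>t. F (\<lambda>k. ennreal (approx_real m t k))) ` unit_irrats"
  assumes \<sigma>: "\<bar>\<sigma>\<bar> = 1" and F: "\<And>x v. (\<And>k. 0 \<le> x k) \<Longrightarrow> 0 \<le> v \<Longrightarrow>
      F (\<lambda>k. ennreal (x k)) = ennreal v \<longleftrightarrow> extremal_cluster \<sigma> x v"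
    and E: "E \<in> X"
    and away: "\<And>V. V \<in> closure X \<Longrightarrow> V \<noteq> E \<Longrightarrow> \<exists>U M. open U \<and> V \<in> U \<and> \<infinity> \<notin> U \<and>
      (\<forall>t\<in>unit_irrats. F (\<lambda>k. ennreal (approx_real m t k)) \<in> U \<longrightarrow>
        (\<forall>\<^sub>F k in sequentially. cf_digit t k \<le> M))"
  shows "closed X"
  unfolding closed_sequential_limits
proof (intro allI impI)
  fix f V
  assume "(\<forall>n. f n \<in> X) \<and> f \<longlonglongrightarrow> V"
  then have f: "\<And>n. f n \<in> X" and V: "f \<longlonglongrightarrow> V"
    by auto
  show "V \<in> X"
  proof (cases "V = E")
    case False
    have "V \<in> closure X"
      using f V closure_sequential by blast
    then obtain U M where U: "open U" "V \<in> U" "\<infinity> \<notin> U" and M: "\<And>t. t \<in> unit_irrats \<Longrightarrow>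
        F (\<lambda>k. ennreal (approx_real m t k)) \<in> U \<Longrightarrow> \<forall>\<^sub>F k in sequentially. cf_digit t k \<le> M"
      using away[OF _ False] by metis
    obtain n\<^sub>0 where n\<^sub>0: "\<And>n. n\<^sub>0 \<le> n \<Longrightarrow> f n \<in> U"
      using topological_tendstoD[OF V U(1,2)] unfolding eventually_sequentially by blast
    have "\<exists>t\<in>unit_irrats. f (n + n\<^sub>0) = F (\<lambda>k. ennreal (approx_real m t k))" for n
      using f[of "n + n\<^sub>0"] by (auto simp: X_def)
    then obtain \<alpha> where \<alpha>: "\<And>n. \<alpha> n \<in> unit_irrats"
      "\<And>n. f (n + n\<^sub>0) = F (\<lambda>k. ennreal (approx_real m (\<alpha> n) k))"
      by metis
    define v where "v n = enn2real (f (n + n\<^sub>0))" for n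
    have v: "f (n + n\<^sub>0) = ennreal (v n)" "0 \<le> v n" for n
    proof -
      have "f (n + n\<^sub>0) \<noteq> \<infinity>"
        using n\<^sub>0[of "n + n\<^sub>0"] U(3) by auto
      then show "f (n + n\<^sub>0) = ennreal (v n)"
        by (simp add: v_def less_top)
    qed (simp add: v_def)
    define w where "w = enn2real V"
    have "V \<noteq> \<infinity>"
      using U by auto
    then have w: "V = ennreal w" "0 \<le> w"
      by (simp_all add: w_def less_top)
    have "(\<lambda>n. f (n + n\<^sub>0)) \<longlonglongrightarrow> V"
      using V by (rule LIMSEQ_ignore_initial_segment)
    then have "(\<lambda>n. ennreal (v n)) \<longlonglongrightarrow> ennreal w"
      by (simp only: v(1) w(1))
    then have "v \<longlonglongrightarrow> w"
      using v(2) w(2) by simp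
    moreover have "extremal_cluster \<sigma> (approx_real m (\<alpha> n)) (v n)" for n
      using F[of "approx_real m (\<alpha> n)" "v n"] v[of n] \<alpha> by (simp add: approx_real_nonneg)
    moreover have "\<forall>\<^sub>F k in sequentially. cf_digit (\<alpha> n) k \<le> M" for n
      using M[OF \<alpha>(1)] n\<^sub>0[of "n + n\<^sub>0"] \<alpha>(2) by simp
    ultimately have "\<exists>\<beta>\<in>unit_irrats. extremal_cluster \<sigma> (approx_real m \<beta>) w"
      by (intro extremal_cluster_limit[OF window_regular_approx \<sigma>, where \<alpha> = \<alpha> and v = v and M = M] \<alpha>(1))
    then obtain \<beta> where \<beta>: "\<beta> \<in> unit_irrats" "extremal_cluster \<sigma> (approx_real m \<beta>) w"
      by blast
    then have "F (\<lambda>k. ennreal (approx_real m \<beta> k)) = V"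
      using F[of "approx_real m \<beta>" w] w by (simp add: approx_real_nonneg)
    then show ?thesis
      using \<beta>(1) by (auto simp: X_def)
  qed (simp add: E)
qed

text \<open>A witness for the extreme value in all cases: its digits tend to infinity.\<close>

lemma ex_digits_Suc: "\<exists>t\<in>unit_irrats. \<forall>k. cf_digit t k = Suc k"
  by (rule ex_unit_irrat_digits) simp

lemma ennreal_less_approximable:
  fixes V E :: ennreal
  assumes "V < E"
  obtains c where "0 < c" "V < ennreal c" "ennreal c < E"
proof -
  obtain e where e: "V < e" "e < E"
    using dense[OF assms] by blast
  then have "0 < e" "e < \<infinity>"
    using le_less_trans[of 0 V e] less_le_trans[of e E \<infinity>] by auto
  then show thesis
    using that[of "enn2real e"] e by (auto simp: enn2real_positive_iff)
qed

lemma closed_I_set: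
  assumes m: "m \<le> 0"
  shows "closed (I_set m)"
proof -
  let ?L = "\<lambda>t. liminf (\<lambda>k. ennreal (approx_real m t k))"
  have "I_set m = ?L ` unit_irrats"
  proof -
    have "I_set m = (\<lambda>t. liminf (approx_seq m t)) ` unit_irrats"
      by (auto simp: I_set_def unit_irrats_eq)
    also have "\<dots> = ?L ` unit_irrats"
      by (intro image_cong refl liminf_approx_seq)
    finally show ?thesis .
  qed
  moreover have "closed (?L ` unit_irrats)"
  proof (rule closed_extremal_values[where \<sigma> = "-1" and E = 0])
    obtain t where t: "t \<in> unit_irrats" "\<And>k. cf_digit t k = Suc k"
      using ex_digits_Suc by blast
    have "(\<lambda>k. approx_real m t k) \<longlonglongrightarrow> 0"
    proof (rule tendsto_sandwich[where f = "\<lambda>_. 0"])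
      show "\<forall>\<^sub>F k in sequentially. approx_real m t k \<le> 1 / real (Suc k)"
        using approx_real_nonpos_le[OF t(1) m] t(2) by (intro always_eventually) metis
      show "(\<lambda>k. 1 / real (Suc k)) \<longlonglongrightarrow> 0"
        using LIMSEQ_inverse_real_of_nat by (simp add: inverse_eq_divide)
    qed (simp_all add: approx_real_nonneg t(1))
    then have "(\<lambda>k. ennreal (approx_real m t k)) \<longlonglongrightarrow> ennreal 0"
      by (rule tendsto_ennrealI)
    then have "?L t = 0"
      by (simp add: lim_imp_Liminf)
    then show "0 \<in> ?L ` unit_irrats"
      using t(1) by force
  next
    fix V
    assume V: "V \<in> closure (?L ` unit_irrats)" "V \<noteq> 0"
    have "?L t \<le> 1" if "t \<in> unit_irrats" for t
    proof -
      have "?L t \<le> liminf (\<lambda>k. 1 :: ennreal)"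
        using approx_real_le_1[OF that, of m] m by (intro Liminf_mono always_eventually) auto
      then show ?thesis
        by (simp add: Liminf_const)
    qed
    then have "closure (?L ` unit_irrats) \<subseteq> {..1}"
      by (intro closure_minimal) auto
    then have "V \<le> 1"
      using V(1) by auto
    then have "V < \<infinity>"
      by (rule le_less_trans) simp
    have "0 < V"
      using V(2) by (simp add: zero_less_iff_neq_zero)
    then obtain c where c: "0 < c" "ennreal c < V"
      by (rule ennreal_less_approximable)
    have "\<forall>\<^sub>F k in sequentially. cf_digit t k \<le> nat \<lceil>1 / c\<rceil>"
      if t: "t \<in> unit_irrats" and L: "?L t \<in> {ennreal c<..<\<infinity>}" for t
    proof -
      have "\<forall>\<^sub>F k in sequentially. ennreal c < ennreal (approx_real m t k)"
        using L by (intro less_LiminfD) simp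
      then show ?thesis
      proof eventually_elim
        case (elim k)
        then have "c < 1 / cf_digit t k"
          using approx_real_nonpos_le[OF t m, of k] c(1) by (simp add: ennreal_less_iff)
        then have "cf_digit t k \<le> 1 / c"
          using c(1) cf_digit_ge1[OF t, of k] by (simp add: field_simps)
        then show ?case
          by linarith
      qed
    qed
    then show "\<exists>U M. open U \<and> V \<in> U \<and> \<infinity> \<notin> U \<and>
        (\<forall>t\<in>unit_irrats. ?L t \<in> U \<longrightarrow> (\<forall>\<^sub>F k in sequentially. cf_digit t k \<le> M))"
      using c \<open>V < \<infinity>\<close>
      by (intro exI[of _ "{ennreal c<..<\<infinity>}"] exI[of _ "nat \<lceil>1 / c\<rceil>"]) auto
  qed (simp_all add: liminf_ennreal_iff)
  ultimately show ?thesis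
    by simp
qed

text \<open>For upper limits \<open>E\<close> is the largest value, so being away from \<open>E\<close> means that the sequence
  eventually stays below some \<open>c < E\<close>.\<close>

lemma closed_limsup_values:
  fixes E :: ennreal and m :: int
  defines "L \<equiv> \<lambda>t. limsup (\<lambda>k. ennreal (approx_real m t k))"
  assumes E: "E \<in> L ` unit_irrats" and le: "\<And>t. t \<in> unit_irrats \<Longrightarrow> L t \<le> E"
    and bounded: "\<And>c. 0 < c \<Longrightarrow> ennreal c < E \<Longrightarrow> \<exists>M. \<forall>t\<in>unit_irrats.
      (\<forall>\<^sub>F k in sequentially. approx_real m t k < c) \<longrightarrow> (\<forall>\<^sub>F k in sequentially. cf_digit t k \<le> M)"
  shows "closed (S_set m)"
proof -
  have "S_set m = L ` unit_irrats"
  proof -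
    have "S_set m = (\<lambda>t. limsup (approx_seq m t)) ` unit_irrats"
      by (auto simp: S_set_def unit_irrats_eq)
    also have "\<dots> = L ` unit_irrats"
      unfolding L_def by (intro image_cong refl limsup_approx_seq)
    finally show ?thesis .
  qed
  moreover have "closed (L ` unit_irrats)"
    unfolding L_def
  proof (rule closed_extremal_values[where \<sigma> = 1 and E = E])
    show "E \<in> (\<lambda>t. limsup (\<lambda>k. ennreal (approx_real m t k))) ` unit_irrats"
      using E by (simp add: L_def)
    fix V
    assume V: "V \<in> closure ((\<lambda>t. limsup (\<lambda>k. ennreal (approx_real m t k))) ` unit_irrats)" "V \<noteq> E"
    have "closure (L ` unit_irrats) \<subseteq> {..E}"
      using le by (intro closure_minimal) auto
    then have "V < E"
      using V by (auto simp: L_def less_le)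
    then obtain c where c: "0 < c" "V < ennreal c" "ennreal c < E"
      by (rule ennreal_less_approximable)
    obtain M where M: "\<And>t. t \<in> unit_irrats \<Longrightarrow> \<forall>\<^sub>F k in sequentially. approx_real m t k < c \<Longrightarrow>
        \<forall>\<^sub>F k in sequentially. cf_digit t k \<le> M"
      using bounded[OF c(1,3)] by blast
    have "\<forall>\<^sub>F k in sequentially. cf_digit t k \<le> M"
      if t: "t \<in> unit_irrats" and less: "limsup (\<lambda>k. ennreal (approx_real m t k)) \<in> {..<ennreal c}" for t
    proof (rule M[OF t])
      have "\<forall>\<^sub>F k in sequentially. ennreal (approx_real m t k) < ennreal c"
        using less by (intro Limsup_lessD) simp
      then show "\<forall>\<^sub>F k in sequentially. approx_real m t k < c"
        by eventually_elim (simp add: ennreal_less_iff approx_real_nonneg t)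
    qed
    then show "\<exists>U M. open U \<and> V \<in> U \<and> \<infinity> \<notin> U \<and> (\<forall>t\<in>unit_irrats.
        limsup (\<lambda>k. ennreal (approx_real m t k)) \<in> U \<longrightarrow> (\<forall>\<^sub>F k in sequentially. cf_digit t k \<le> M))"
      using c by (intro exI[of _ "{..<ennreal c}"] exI[of _ M]) auto
  qed (simp_all add: limsup_ennreal_iff)
  ultimately show ?thesis
    by simp
qed

lemma closed_S_set_1: "closed (S_set 1)"
proof (rule closed_limsup_values[where E = 1])
  obtain t where t: "t \<in> unit_irrats" "\<And>k. cf_digit t k = Suc k"
    using ex_digits_Suc by blast
  have "(\<lambda>k. approx_real 1 t k) \<longlonglongrightarrow> 1"
  proof (rule tendsto_sandwich[where h = "\<lambda>_. 1"])
    show "\<forall>\<^sub>F k in sequentially. 1 - 1 / real (Suc k) \<le> approx_real 1 t k"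
      using approx_real_1_bounds(2)[OF t(1)] t(2) by (intro always_eventually) metis
    have "(\<lambda>k. 1 / real (Suc k)) \<longlonglongrightarrow> 0"
      using LIMSEQ_inverse_real_of_nat by (simp add: inverse_eq_divide)
    from tendsto_diff[OF tendsto_const this, of 1]
    show "(\<lambda>k. 1 - 1 / real (Suc k)) \<longlonglongrightarrow> 1"
      by simp
  qed (simp_all add: approx_real_1_bounds(1) t(1))
  then have "(\<lambda>k. ennreal (approx_real 1 t k)) \<longlonglongrightarrow> ennreal 1"
    by (rule tendsto_ennrealI)
  then have "limsup (\<lambda>k. ennreal (approx_real 1 t k)) = 1"
    by (simp add: lim_imp_Limsup)
  then show "1 \<in> (\<lambda>t. limsup (\<lambda>k. ennreal (approx_real 1 t k))) ` unit_irrats"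
    using t(1) by force
next
  fix t
  assume "t \<in> unit_irrats"
  then show "limsup (\<lambda>k. ennreal (approx_real 1 t k)) \<le> 1"
    using approx_real_1_bounds(1) by (intro Limsup_bounded always_eventually) auto
next
  fix c :: real
  assume c: "0 < c" "ennreal c < 1"
  then have "c < 1"
    by (simp add: ennreal_less_iff flip: ennreal_1)
  show "\<exists>M. \<forall>t\<in>unit_irrats. (\<forall>\<^sub>F k in sequentially. approx_real 1 t k < c) \<longrightarrow>
      (\<forall>\<^sub>F k in sequentially. cf_digit t k \<le> M)"
  proof (intro exI ballI impI)
    fix t
    assume t: "t \<in> unit_irrats" and less: "\<forall>\<^sub>F k in sequentially. approx_real 1 t k < c"
    from less show "\<forall>\<^sub>F k in sequentially. cf_digit t k \<le> nat \<lceil>1 / (1 - c)\<rceil>"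
    proof eventually_elim
      case (elim k)
      then have "1 - c < 1 / cf_digit t k"
        using approx_real_1_bounds(2)[OF t, of k] by linarith
      then have "cf_digit t k \<le> 1 / (1 - c)"
        using \<open>c < 1\<close> cf_digit_ge1[OF t, of k] by (simp add: field_simps)
      then show ?case
        by linarith
    qed
  qed
qed

lemma closed_S_set_ge_2:
  assumes m: "2 \<le> m"
  shows "closed (S_set m)"
proof (rule closed_limsup_values[where E = \<infinity>])
  obtain t where t: "t \<in> unit_irrats" "\<And>k. cf_digit t k = Suc k"
    using ex_digits_Suc by blast
  have "\<infinity> \<le> limsup (\<lambda>k. ennreal (approx_real m t k))"
  proof (rule ccontr)
    assume "\<not> ?thesis"
    then have "limsup (\<lambda>k. ennreal (approx_real m t k)) < \<infinity>"
      by simp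
    then obtain c where c: "limsup (\<lambda>k. ennreal (approx_real m t k)) < ennreal c"
      by (rule ennreal_less_approximable)
    then have "\<forall>\<^sub>F k in sequentially. ennreal (approx_real m t k) < ennreal c"
      by (rule Limsup_lessD)
    then have "\<forall>\<^sub>F k in sequentially. ennreal (approx_real m t k) < ennreal c \<and> nat \<lceil>2 * c\<rceil> \<le> k"
      by (intro eventually_conj eventually_ge_at_top)
    then obtain k where k: "ennreal (approx_real m t k) < ennreal c" "nat \<lceil>2 * c\<rceil> \<le> k"
      using eventually_happens[of _ sequentially] by auto
    have "approx_real m t k < c"
      using k(1) by (simp add: ennreal_less_iff approx_real_nonneg t(1))
    moreover have "2 * c \<le> real k"
      using k(2) real_nat_ceiling_ge[of "2 * c"] by linarith
    then have "c \<le> real (cf_digit t (k + nat (m - 1))) / 2"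
      by (simp add: t(2))
    ultimately show False
      using approx_real_ge_digit[OF t(1) m, of k] by linarith
  qed
  then show "\<infinity> \<in> (\<lambda>t. limsup (\<lambda>k. ennreal (approx_real m t k))) ` unit_irrats"
    using t(1) by (auto simp: top_unique intro!: image_eqI[of _ _ t])
next
  fix c :: real
  show "\<exists>M. \<forall>t\<in>unit_irrats. (\<forall>\<^sub>F k in sequentially. approx_real m t k < c) \<longrightarrow>
      (\<forall>\<^sub>F k in sequentially. cf_digit t k \<le> M)"
  proof (intro exI ballI impI)
    fix t
    assume t: "t \<in> unit_irrats" and "\<forall>\<^sub>F k in sequentially. approx_real m t k < c"
    then obtain K where K: "\<And>k. K \<le> k \<Longrightarrow> approx_real m t k < c"
      unfolding eventually_sequentially by blast
    have "cf_digit t k \<le> nat \<lceil>2 * c\<rceil>" if "K + nat (m - 1) \<le> k" for k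
    proof -
      have "approx_real m t (k - nat (m - 1)) < c"
        using that by (intro K) linarith
      then have "cf_digit t k / 2 < c"
        using approx_real_ge_digit[OF t m, of "k - nat (m - 1)"] that by simp
      then show ?thesis
        by linarith
    qed
    then show "\<forall>\<^sub>F k in sequentially. cf_digit t k \<le> nat \<lceil>2 * c\<rceil>"
      unfolding eventually_sequentially by blast
  qed
qed simp

theorem theorem51:
  shows "(\<forall>m::int. m \<le> 0 \<longrightarrow> closed (I_set m)) \<and> (\<forall>m::int. m \<ge> 1 \<longrightarrow> closed (S_set m))"
proof (intro conjI allI impI)
  fix m :: int
  show "closed (I_set m)" if "m \<le> 0"
    using that by (rule closed_I_set)
  show "closed (S_set m)" if "1 \<le> m"
    using that closed_S_set_1 closed_S_set_ge_2[of m] by (cases "m = 1") auto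
qed

end
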